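(* Let $V$ be the $\mathcal O_q$-module, with associated notation, described in the context, and put $$M=\frac{aK-a^{-1}B}{a-a^{-1}},\quad N=\frac{a^{-1}K^{-1}-aB^{-1}}{a^{-1}-a},\quad M^\downarrow=\frac{aK^\downarrow-a^{-1}B^\downarrow}{a-a^{-1}},\quad N^\downarrow=\frac{a^{-1}(K^\downarrow)^{-1}-a(B^\downarrow)^{-1}}{a^{-1}-a}.$$ Then each of the following eight 3-tuples $X,Y,Z$ is an equitable triple on $V$: (1) $aA-a^2K,\ M^{-1},\ K$; (2) $a^{-1}A-a^{-2}B,\ M^{-1},\ B$; (3) $aA-a^2K^\downarrow,\ (M^\downarrow)^{-1},\ K^\downarrow$; (4) $a^{-1}A-a^{-2}B^\downarrow,\ (M^\downarrow)^{-1},\ B^\downarrow$; (5) $K^{-1},\ N^{-1},\ a^{-1}A-a^{-2}K^{-1}$; (6) $B^{-1},\ N^{-1},\ aA-a^2B^{-1}$; (7) $(K^\downarrow)^{-1},\ (N^\downarrow)^{-1},\ a^{-1}A-a^{-2}(K^\downarrow)^{-1}$; (8) $(B^\downarrow)^{-1},\ (N^\downarrow)^{-1},\ aA-a^2(B^\downarrow)^{-1}$.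
   Context: Setting. $\mathbb F$ is a field and $q\in\mathbb F$ is nonzero and not a root of unity. Algebras are associative, unital, over $\mathbb F$. Write $[X,Y]=XY-YX$, $[X,Y]_q=qXY-q^{-1}YX$, $[X,Y]_{q^{-1}}=q^{-1}XY-qYX$. The $q$-Onsager algebra $\mathcal O_q$ is defined by generators $A,A^*$ and relations $[A,[A,[A,A^*]_q]_{q^{-1}}]=(q^2-q^{-2})^2[A^*,A]$ and $[A^*,[A^*,[A^*,A]_q]_{q^{-1}}]=(q^2-q^{-2})^2[A,A^*]$. $V$ is an irreducible $\mathcal O_q$-module of finite dimension at least $2$ on which each of $A,A^*$ is diagonalizable; elements of $\mathcal O_q$ are identified with their actions on $V$. Eigenspaces. The eigenvalues of $A$ on $V$ can be ordered as mutually distinct $\theta_0,\dots,\theta_d$ ($d\ge 1$) such that $\theta_i=aq^{d-2i}+a^{-1}q^{2i-d}$ ($0\le i\le d$) for some nonzero $a\in\mathbb F$; fix such an ordering and $a$. $V_i$ is the $\theta_i$-eigenspace of $A$; one has $A^*V_i\subseteq V_{i-1}+V_i+V_{i+1}$ ($V_{-1}=V_{d+1}=0$). $A^*$ also has exactly $d+1$ eigenspaces on $V$, and they can be ordered $V^*_0,\dots,V^*_d$ so that $AV^*_i\subseteq V^*_{i-1}+V^*_i+V^*_{i+1}$ ($V^*_{-1}=V^*_{d+1}=0$); fix such an ordering. One has $a^2\ne 1$. Maps. A decomposition of $V$ is a sequence $\{W_i\}_{i=0}^d$ of nonzero subspaces with direct sum $V$; its corresponding map is the element of $\mathrm{End}(V)$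 acting on $W_i$ as $q^{d-2i}$ times the identity ($0\le i\le d$). $K,B,K^\downarrow,B^\downarrow$ are the maps corresponding to the decompositions $\{W_i\}_{i=0}^d$ (each known to be a decomposition) given respectively by: $K$: $W_i=(V^*_0+\cdots+V^*_i)\cap(V_i+\cdots+V_d)$; $B$: $W_i=(V^*_0+\cdots+V^*_i)\cap(V_0+\cdots+V_{d-i})$; $K^\downarrow$: $W_i=(V^*_{d-i}+\cdots+V^*_d)\cap(V_i+\cdots+V_d)$; $B^\downarrow$: $W_i=(V^*_{d-i}+\cdots+V^*_d)\cap(V_0+\cdots+V_{d-i})$. The maps $M,N,M^\downarrow,N^\downarrow$ of the claim are known to be invertible (they are diagonalizable with eigenvalues $\{q^{d-2i}\}_{i=0}^d$). Equitable triple. An equitable triple on $V$ is a 3-tuple $X,Y,Z$ of invertible elements of $\mathrm{End}(V)$ such that $\frac{qXY-q^{-1}YX}{q-q^{-1}}=I$, $\frac{qYZ-q^{-1}ZY}{q-q^{-1}}=I$, $\frac{qZX-q^{-1}XZ}{q-q^{-1}}=I$. *)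

theory Defs
  imports
    Complex_Main
    "HOL-Library.Poly_Mapping"
    "HOL-Library.Set_Algebras"
    "HOL-Algebra.QuotRing"
begin

section \<open>The \<open>q\<close>-Onsager algebra\<close>

datatype onsager_gen = Gen_A | Gen_Astar

text \<open>
  The additive monoid structure on words below is concatenation; \<open>gen_word \<Rightarrow>\<^sub>0 'f\<close>, with the
  convolution product of \<^theory>\<open>HOL-Library.Poly_Mapping\<close>, is then the free unital
  associative algebra on the two generators.
\<close>

datatype gen_word = Word "onsager_gen list"

instantiation gen_word :: monoid_add
begin

definition zero_gen_word :: gen_word where
  "0 = Word []"

fun plus_gen_word :: "gen_word \<Rightarrow> gen_word \<Rightarrow> gen_word" where
  "Word u + Word v = Word (u @ v)"

instance
proof
  fix u v w :: gen_word
  show "u + v + w = u + (v + w)" by (cases u; cases v; cases w) simp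
  show "0 + u = u" by (cases u) (simp add: zero_gen_word_def)
  show "u + 0 = u" by (cases u) (simp add: zero_gen_word_def)
qed

end

type_synonym 'f free_alg = "gen_word \<Rightarrow>\<^sub>0 'f"

abbreviation free_const :: "'f::field \<Rightarrow> 'f free_alg" where
  "free_const c \<equiv> Poly_Mapping.single 0 c"

definition free_gen :: "onsager_gen \<Rightarrow> 'f::field free_alg" where
  "free_gen g = Poly_Mapping.single (Word [g]) 1"

definition comm_bracket :: "'f::field free_alg \<Rightarrow> 'f free_alg \<Rightarrow> 'f free_alg" where
  "comm_bracket X Y = X * Y - Y * X"

text \<open>\<open>[X,Y]\<^sub>r = r X Y - r\<inverse> Y X\<close>\<close>

definition q_bracket :: "'f::field \<Rightarrow> 'f free_alg \<Rightarrow> 'f free_alg \<Rightarrow> 'f free_alg" where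
  "q_bracket r X Y = free_const r * X * Y - free_const (inverse r) * Y * X"

text \<open>Left-hand side minus right-hand side of
  \<open>[X,[X,[X,Y]\<^sub>q]\<^bsub>q\<inverse>\<^esub>] = (q\<^sup>2 - q\<inverse>\<^sup>2)\<^sup>2 [Y,X]\<close>.\<close>

definition onsager_relator :: "'f::field \<Rightarrow> 'f free_alg \<Rightarrow> 'f free_alg \<Rightarrow> 'f free_alg" where
  "onsager_relator q X Y =
     comm_bracket X (q_bracket (inverse q) X (q_bracket q X Y))
     - free_const ((q\<^sup>2 - (inverse q)\<^sup>2)\<^sup>2) * comm_bracket Y X"

definition free_ring :: "'f::field free_alg ring" where
  "free_ring = \<lparr>carrier = UNIV, mult = (*), one = 1, zero = 0, add = (+)\<rparr>"

definition onsager_ideal :: "'f::field \<Rightarrow> 'f free_alg set" where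
  "onsager_ideal q = Idl\<^bsub>free_ring\<^esub>
     {onsager_relator q (free_gen Gen_A) (free_gen Gen_Astar),
      onsager_relator q (free_gen Gen_Astar) (free_gen Gen_A)}"

definition q_onsager :: "'f::field \<Rightarrow> 'f free_alg set ring" where
  "q_onsager q = free_ring Quot onsager_ideal q"

definition onsager_class :: "'f::field \<Rightarrow> 'f free_alg \<Rightarrow> 'f free_alg set" where
  "onsager_class q x = onsager_ideal q +>\<^bsub>free_ring\<^esub> x"

section \<open>Modules\<close>

definition End_ring :: "('f::field \<Rightarrow> 'v::ab_group_add \<Rightarrow> 'v) \<Rightarrow> ('v \<Rightarrow> 'v) ring" where
  "End_ring scale = \<lparr>carrier = {f. Vector_Spaces.linear scale scale f},
     mult = (\<circ>), one = id, zero = (\<lambda>v. 0), add = (\<lambda>f g v. f v + g v)\<rparr>"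

text \<open>The second conjunct makes the ring homomorphism \<open>\<rho>\<close> a homomorphism of \<open>'f\<close>-algebras.\<close>

definition onsager_module ::
  "('f::field \<Rightarrow> 'v::ab_group_add \<Rightarrow> 'v) \<Rightarrow> 'f \<Rightarrow> ('f free_alg set \<Rightarrow> 'v \<Rightarrow> 'v) \<Rightarrow> bool" where
  "onsager_module scale q \<rho> \<longleftrightarrow>
     \<rho> \<in> ring_hom (q_onsager q) (End_ring scale) \<and>
     (\<forall>c. \<rho> (onsager_class q (free_const c)) = scale c)"

definition onsager_irreducible ::
  "('f::field \<Rightarrow> 'v::ab_group_add \<Rightarrow> 'v) \<Rightarrow> 'f \<Rightarrow> ('f free_alg set \<Rightarrow> 'v \<Rightarrow> 'v) \<Rightarrow> bool" where
  "onsager_irreducible scale q \<rho> \<longleftrightarrow>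
     (UNIV :: 'v set) \<noteq> {0} \<and>
     (\<forall>W. module.subspace scale W \<and> (\<forall>x\<in>carrier (q_onsager q). \<rho> x ` W \<subseteq> W)
        \<longrightarrow> W = {0} \<or> W = UNIV)"

section \<open>Linear algebra\<close>

definition eigenspace ::
  "('f::field \<Rightarrow> 'v::ab_group_add \<Rightarrow> 'v) \<Rightarrow> ('v \<Rightarrow> 'v) \<Rightarrow> 'f \<Rightarrow> 'v set" where
  "eigenspace scale f c = {v. f v = scale c v}"

definition eigenvalues ::
  "('f::field \<Rightarrow> 'v::ab_group_add \<Rightarrow> 'v) \<Rightarrow> ('v \<Rightarrow> 'v) \<Rightarrow> 'f set" where
  "eigenvalues scale f = {c. \<exists>v. v \<noteq> 0 \<and> f v = scale c v}"

definition diagonalizable ::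
  "('f::field \<Rightarrow> 'v::ab_group_add \<Rightarrow> 'v) \<Rightarrow> ('v \<Rightarrow> 'v) \<Rightarrow> bool" where
  "diagonalizable scale f \<longleftrightarrow>
     module.span scale (\<Union>c\<in>eigenvalues scale f. eigenspace scale f c) = UNIV"

text \<open>Sums of subspaces are the pointwise set sums of \<^theory>\<open>HOL-Library.Set_Algebras\<close>; the empty
  sum is \<open>{0}\<close>.\<close>

definition decomposition ::
  "('f::field \<Rightarrow> 'v::ab_group_add \<Rightarrow> 'v) \<Rightarrow> nat \<Rightarrow> (nat \<Rightarrow> 'v set) \<Rightarrow> bool" where
  "decomposition scale d W \<longleftrightarrow>
     (\<forall>i\<le>d. module.subspace scale (W i) \<and> W i \<noteq> {0}) \<and>
     (\<Sum>i\<le>d. W i) = UNIV \<and>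
     (\<forall>w. (\<forall>i\<le>d. w i \<in> W i) \<and> (\<Sum>i\<le>d. w i) = 0 \<longrightarrow> (\<forall>i\<le>d. w i = 0))"

text \<open>Only meaningful when \<open>W\<close> is a decomposition; see \<open>corresponding_map_ex1\<close> below.\<close>

definition corresponding_map ::
  "('f::field \<Rightarrow> 'v::ab_group_add \<Rightarrow> 'v) \<Rightarrow> 'f \<Rightarrow> nat \<Rightarrow> (nat \<Rightarrow> 'v set) \<Rightarrow> 'v \<Rightarrow> 'v" where
  "corresponding_map scale q d W =
     (THE f. Vector_Spaces.linear scale scale f \<and>
        (\<forall>i\<le>d. \<forall>w\<in>W i. f w = scale (q powi (int d - 2 * int i)) w))"

definition equitable_triple ::
  "('f::field \<Rightarrow> 'v::ab_group_add \<Rightarrow> 'v) \<Rightarrow> 'f \<Rightarrow> ('v \<Rightarrow> 'v) \<Rightarrow> ('v \<Rightarrow> 'v) \<Rightarrow> ('v \<Rightarrow> 'v) \<Rightarrow> bool"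
where
  "equitable_triple scale q X Y Z \<longleftrightarrow>
     X \<in> Units (End_ring scale) \<and> Y \<in> Units (End_ring scale) \<and> Z \<in> Units (End_ring scale) \<and>
     (\<forall>v. scale (1 / (q - inverse q)) (scale q (X (Y v)) - scale (inverse q) (Y (X v))) = v) \<and>
     (\<forall>v. scale (1 / (q - inverse q)) (scale q (Y (Z v)) - scale (inverse q) (Z (Y v))) = v) \<and>
     (\<forall>v. scale (1 / (q - inverse q)) (scale q (Z (X v)) - scale (inverse q) (X (Z v))) = v)"

section \<open>Basic facts\<close>

lemma ring_free_ring: "ring (free_ring :: 'f::field free_alg ring)"
proof (rule ringI)
  show "abelian_group (free_ring :: 'f free_alg ring)"
  proof (rule abelian_groupI)
    fix x :: "'f free_alg"
    show "\<exists>y\<in>carrier free_ring. y \<oplus>\<^bsub>free_ring\<^esub> x = \<zero>\<^bsub>free_ring\<^esub>"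
      by (rule bexI[of _ "- x"]) (simp_all add: free_ring_def)
  qed (simp_all add: free_ring_def algebra_simps)
  show "Group.monoid (free_ring :: 'f free_alg ring)"
    by (rule Group.monoidI) (simp_all add: free_ring_def algebra_simps)
qed (simp_all add: free_ring_def algebra_simps)

lemma ideal_onsager_ideal: "ideal (onsager_ideal q) free_ring"
  unfolding onsager_ideal_def
  by (rule ring.genideal_ideal[OF ring_free_ring]) (simp add: free_ring_def)

lemma ring_q_onsager: "ring (q_onsager q)"
  unfolding q_onsager_def by (rule ideal.quotient_is_ring[OF ideal_onsager_ideal])

lemma onsager_class_ring_hom: "onsager_class q \<in> ring_hom free_ring (q_onsager q)"
  using ideal.rcos_ring_hom[OF ideal_onsager_ideal[of q]]
  unfolding q_onsager_def onsager_class_def .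

lemma onsager_class_relator:
  "onsager_class q (onsager_relator q (free_gen Gen_A) (free_gen Gen_Astar)) = \<zero>\<^bsub>q_onsager q\<^esub>"
  "onsager_class q (onsager_relator q (free_gen Gen_Astar) (free_gen Gen_A)) = \<zero>\<^bsub>q_onsager q\<^esub>"
proof -
  let ?S = "{onsager_relator q (free_gen Gen_A) (free_gen Gen_Astar),
      onsager_relator q (free_gen Gen_Astar) (free_gen Gen_A)}"
  have sub: "?S \<subseteq> onsager_ideal q"
    unfolding onsager_ideal_def
    by (rule ring.genideal_self[OF ring_free_ring]) (simp add: free_ring_def)
  interpret I: ideal "onsager_ideal q" free_ring by (rule ideal_onsager_ideal)
  have "onsager_class q x = \<zero>\<^bsub>q_onsager q\<^esub>" if "x \<in> onsager_ideal q" for x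
    using I.a_rcos_const[OF that] by (simp add: onsager_class_def q_onsager_def FactRing_def)
  with sub show
    "onsager_class q (onsager_relator q (free_gen Gen_A) (free_gen Gen_Astar)) = \<zero>\<^bsub>q_onsager q\<^esub>"
    "onsager_class q (onsager_relator q (free_gen Gen_Astar) (free_gen Gen_A)) = \<zero>\<^bsub>q_onsager q\<^esub>"
    by auto
qed

lemma onsager_module_relations:
  fixes \<rho> :: "'f::field free_alg set \<Rightarrow> 'v::ab_group_add \<Rightarrow> 'v"
    and scale :: "'f \<Rightarrow> 'v \<Rightarrow> 'v"
  defines "cb \<equiv> \<lambda>X Y v. X (Y v) - Y (X v)"
    and "qb \<equiv> \<lambda>r X Y v. scale r (X (Y v)) - scale (inverse r) (Y (X v))"
  assumes vs: "vector_space scale" and m: "onsager_module scale q \<rho>"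
    and XY: "{X, Y} = {free_gen Gen_A, free_gen Gen_Astar}"
  defines "f \<equiv> \<rho> (onsager_class q X)" and "g \<equiv> \<rho> (onsager_class q Y)"
  shows "cb f (qb (inverse q) f (qb q f g)) v = scale ((q\<^sup>2 - (inverse q)\<^sup>2)\<^sup>2) (cb g f v)"
proof -
  interpret vector_space scale by (rule vs)
  define h where "h x = \<rho> (onsager_class q x)" for x
  have hom: "h \<in> ring_hom free_ring (End_ring scale)"
    using ring_hom_trans[OF onsager_class_ring_hom, of \<rho> q "End_ring scale"] m
    by (simp add: onsager_module_def h_def[abs_def] comp_def)
  have h_mult: "h (x * y) = h x \<circ> h y" and h_add: "h (x + y) = (\<lambda>v. h x v + h y v)" for x y
    using ring_hom_mult[OF hom, of x y] ring_hom_add[OF hom, of x y]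
    by (simp_all add: free_ring_def End_ring_def)
  have h_const: "h (free_const c) = scale c" for c
    using m by (simp add: h_def onsager_module_def)
  have h_diff: "h (x - y) v = h x v - h y v" for x y v
    using fun_cong[OF h_add[of "x - y" y], of v] by simp
  have h_cb: "h (comm_bracket x y) = cb (h x) (h y)" for x y
    by (rule ext) (simp add: comm_bracket_def cb_def h_diff h_mult)
  have h_qb: "h (q_bracket r x y) = qb r (h x) (h y)" for r x y
    by (rule ext) (simp add: q_bracket_def qb_def h_diff h_mult h_const)
  have "onsager_class q (onsager_relator q X Y) = \<zero>\<^bsub>q_onsager q\<^esub>"
    using XY onsager_class_relator[of q] by (auto simp: doubleton_eq_iff)
  also have "\<dots> = onsager_class q 0"
    using onsager_class_relator(1)[of q] ring_hom_zero[OF onsager_class_ring_hom ring_free_ring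
        ring_q_onsager, of q] by (simp add: free_ring_def)
  finally have "h (onsager_relator q X Y) v = h (free_const 0) v"
    by (simp add: h_def)
  then have "h (onsager_relator q X Y) v = 0"
    by (simp only: h_const scale_zero_left)
  then show ?thesis
    by (simp add: onsager_relator_def h_diff h_mult h_const h_cb h_qb f_def g_def flip: h_def)
qed

lemma corresponding_map_ex1:
  assumes vs: "vector_space scale" and dec: "decomposition scale d W"
  shows "\<exists>!f. Vector_Spaces.linear scale scale f \<and>
        (\<forall>i\<le>d. \<forall>w\<in>W i. f w = scale (q powi (int d - 2 * int i)) w)"
proof -
  interpret vector_space scale by (rule vs)
  define t where "t i = q powi (int d - 2 * int i)" for i
  have sub: "subspace (W i)" if "i \<le> d" for i
    using dec that by (simp add: decomposition_def)
  have indep: "w i = 0" if "\<And>i. i \<le> d \<Longrightarrow> w i \<in> W i" "(\<Sum>i\<le>d. w i) = 0" "i \<le> d" for w i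
    using dec that unfolding decomposition_def by blast
  have "\<exists>w. (\<forall>i\<le>d. w i \<in> W i) \<and> v = (\<Sum>i\<le>d. w i)" for v
  proof -
    have "v \<in> (\<Sum>i\<le>d. W i)" using dec by (simp add: decomposition_def)
    then show ?thesis unfolding set_sum_alt[OF finite_atMost] by auto
  qed
  then obtain c where c: "\<And>v i. i \<le> d \<Longrightarrow> c v i \<in> W i" "\<And>v. v = (\<Sum>i\<le>d. c v i)"
    by metis
  have c_unique: "c v i = w i"
    if "\<And>i. i \<le> d \<Longrightarrow> w i \<in> W i" "v = (\<Sum>i\<le>d. w i)" "i \<le> d" for v w i
  proof -
    have "c v i - w i = 0"
    proof (rule indep[of "\<lambda>i. c v i - w i"])
      show "c v i - w i \<in> W i" if "i \<le> d" for i
        using that \<open>\<And>i. i \<le> d \<Longrightarrow> w i \<in> W i\<close> c(1) sub subspace_diff by blast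
      show "(\<Sum>i\<le>d. c v i - w i) = 0"
        using c(2)[of v] that(2) by (simp add: sum_subtractf)
    qed (rule that(3))
    then show ?thesis by simp
  qed
  have c_add: "c (u + v) i = c u i + c v i" if "i \<le> d" for u v i
    by (rule c_unique[where w = "\<lambda>i. c u i + c v i", OF _ _ that])
      (use c sub subspace_add in \<open>auto simp: sum.distrib\<close>)
  have c_scale: "c (scale r v) i = scale r (c v i)" if "i \<le> d" for r v i
  proof (rule c_unique[where w = "\<lambda>i. scale r (c v i)", OF _ _ that])
    show "scale r (c v i) \<in> W i" if "i \<le> d" for i using that c(1) sub subspace_scale by blast
    show "scale r v = (\<Sum>i\<le>d. scale r (c v i))"
      using c(2)[of v] by (metis scale_sum_right)
  qed
  define f where "f v = (\<Sum>i\<le>d. scale (t i) (c v i))" for v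
  have lin: "Vector_Spaces.linear scale scale f"
  proof (unfold Vector_Spaces.linear_iff, intro conjI allI vs)
    show "f (u + v) = f u + f v" for u v
      by (simp add: f_def c_add scale_right_distrib sum.distrib)
    show "f (scale r v) = scale r (f v)" for r v
      by (simp add: f_def c_scale scale_sum_right mult.commute)
  qed
  have act: "f w = scale (t i) w" if i: "i \<le> d" and w: "w \<in> W i" for i w
  proof -
    have cw: "c w j = (if j = i then w else 0)" if "j \<le> d" for j
      by (rule c_unique[where w = "\<lambda>j. if j = i then w else 0", OF _ _ that])
        (use i w sub subspace_0 in auto)
    have "f w = (\<Sum>j\<le>d. if j = i then scale (t i) w else 0)"
      unfolding f_def by (rule sum.cong) (auto simp: cw)
    then show ?thesis using i by simp
  qed
  show ?thesis
  proof (rule ex1I[of _ f])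
    show "Vector_Spaces.linear scale scale f \<and>
        (\<forall>i\<le>d. \<forall>w\<in>W i. f w = scale (q powi (int d - 2 * int i)) w)"
      using lin act by (auto simp: t_def)
    fix g
    assume g: "Vector_Spaces.linear scale scale g \<and>
        (\<forall>i\<le>d. \<forall>w\<in>W i. g w = scale (q powi (int d - 2 * int i)) w)"
    then interpret g: Vector_Spaces.linear scale scale g by simp
    show "g = f"
    proof
      fix v
      have "g v = g (\<Sum>i\<le>d. c v i)" using c(2)[of v] by simp
      also have "\<dots> = (\<Sum>i\<le>d. scale (t i) (c v i))"
        unfolding g.sum using g c(1) by (auto simp: t_def intro!: sum.cong)
      finally show "g v = f v" by (simp add: f_def)
    qed
  qed
qed

end

theory Submission
  imports Defs
begin

text \<open>
  Put \<open>t\<^sub>i = q\<^bsup>d-2i\<^esup>\<close>. Partial sums of the eigenspaces of \<open>A\<^sup>*\<close>, taken from one of the two ends,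
  form a flag \<open>F\<close>; partial sums of the eigenspaces of \<open>A\<close> form a flag \<open>G\<close> or, from the other end,
  \<open>H\<close>. Each generator is triangular on its own flag and moves the other flag by at most one step.
  By irreducibility the intersections \<open>U\<^sub>i\<close> of complementary members of \<open>F\<close> and \<open>G\<close> decompose \<open>V\<close>
  (\<open>decomposition_U\<close>), and on \<open>U\<^sub>i\<close> the map \<open>A\<close> is \<open>a t\<^sub>i + (a t\<^sub>i)\<^sup>-\<^sup>1\<close> plus a map into
  \<open>U\<^sub>i\<^sub>+\<^sub>1\<close>, while \<open>A\<^sup>*\<close> is \<open>b t\<^sub>i + (b t\<^sub>i)\<^sup>-\<^sup>1\<close> plus a map into \<open>U\<^sub>i\<^sub>-\<^sub>1\<close>. As \<open>K\<close> is \<open>t\<^sub>i\<close> on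
  \<open>U\<^sub>i\<close>, this says \<open>q\<^sup>2 K(aA) - (aA)K = (q\<^sup>2 - 1)(a\<^sup>2K\<^sup>2 + 1)\<close> and \<open>q\<^sup>2 (bA\<^sup>*)K - K(bA\<^sup>*) = (q\<^sup>2 -
  1)(b\<^sup>2K\<^sup>2 + 1)\<close> (\<open>weight_map_raising\<close>, \<open>weight_map_lowering\<close>). The flags \<open>F\<close> and \<open>H\<close> give \<open>B\<close>,
  with the same relations after \<open>a\<close> is replaced by \<open>a\<^sup>-\<^sup>1\<close>.

  The relation between \<open>aA - a\<^sup>2K\<close> and \<open>K\<close> is immediate from this. The two relations of the first
  triple that involve \<open>M\<close> both amount to the vanishing of one operator \<open>Q\<close>, a quadratic expression
  in \<open>K\<close> and \<open>B\<close>. The commutation relations above imply that \<open>QA\<close> and \<open>QA\<^sup>*\<close> are linear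
  combinations of \<open>AQ\<close> (resp. \<open>A\<^sup>*Q\<close>), \<open>KQ\<close>, \<open>BQ\<close>, \<open>QK\<close> and \<open>QB\<close>. Consequently the largest
  subspace of the kernel of \<open>Q\<close> that is stable under \<open>K\<close> and \<open>B\<close> is stable under \<open>A\<close> and \<open>A\<^sup>*\<close>. It
  contains the first nonzero member of \<open>F\<close>, on which \<open>K\<close> and \<open>B\<close> are the same scalar and the
  coefficients of \<open>Q\<close> add up to zero; by irreducibility it is \<open>V\<close>, so \<open>Q = 0\<close>
  (\<open>quadratic_vanishes\<close>). Invertibility of all maps involved follows because they are triangular
  on \<open>F\<close> or \<open>G\<close> with nonzero diagonal.

  The other seven triples are instances of the first (\<open>equitable_triple_of_splits\<close>). Exchanging \<open>G\<close>
  and \<open>H\<close> replaces \<open>a\<close> by \<open>a\<^sup>-\<^sup>1\<close> and exchanges \<open>K\<close> and \<open>B\<close>; building \<open>F\<close> from the other end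
  replaces \<open>b\<close> by \<open>b\<^sup>-\<^sup>1\<close> and gives the maps with a down arrow; and inverting \<open>q\<close>, \<open>a\<close> and \<open>b\<close>
  together leaves all eigenvalues of \<open>A\<close> and \<open>A\<^sup>*\<close> unchanged, inverts \<open>K\<close> and \<open>B\<close>, and reverses
  the order of an equitable triple.

  The action of \<open>A\<^sup>*\<close> on the flags of \<open>A\<close>, and the form of the eigenvalues of \<open>A\<^sup>*\<close>, come from the
  defining relations: between eigenvectors of \<open>A\<close> with eigenvalues \<open>x \<noteq> y\<close>, a nonzero component of
  \<open>A\<^sup>*\<close> forces a symmetric quadratic equation in \<open>x\<close> and \<open>y\<close> (\<open>onsager_relation_components\<close>).
  Among the \<open>\<theta>\<^sub>i\<close> it holds only for neighbouring indices. With the two generators exchanged,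
  irreducibility makes consecutive eigenvalues of \<open>A\<^sup>*\<close> satisfy it, which determines them up to
  the parameter \<open>b\<close>.
\<close>

section \<open>Linear maps and sums of subspaces\<close>

locale linear_algebra = vector_space scale
  for scale :: "'f::field \<Rightarrow> 'v::ab_group_add \<Rightarrow> 'v" (infixr "*s" 75)
begin

abbreviation lin :: "('v \<Rightarrow> 'v) \<Rightarrow> bool" where "lin f \<equiv> Vector_Spaces.linear scale scale f"

lemma lin_simps:
  assumes "lin f"
  shows "f (x + y) = f x + f y" "f (x - y) = f x - f y" "f (- x) = - f x" "f 0 = 0" "f (r *s x) = r *s f x"
proof -
  interpret f: Vector_Spaces.linear scale scale f by (rule assms)
  show "f (x + y) = f x + f y" "f (x - y) = f x - f y" "f (- x) = - f x" "f 0 = 0" "f (r *s x) = r *s f x"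
    by (simp_all add: f.add f.diff f.neg f.zero f.scale)
qed

lemmas scale_expand = scale_right_distrib scale_right_diff_distrib scale_left_distrib scale_left_diff_distrib

lemma lin_comp: "lin f \<Longrightarrow> lin g \<Longrightarrow> lin (\<lambda>v. f (g v))"
  and lin_scaled: "lin f \<Longrightarrow> lin (\<lambda>v. c *s f v)"
  and lin_diff: "lin f \<Longrightarrow> lin g \<Longrightarrow> lin (\<lambda>v. f v - g v)"
  and lin_plus: "lin f \<Longrightarrow> lin g \<Longrightarrow> lin (\<lambda>v. f v + g v)"
  and lin_ident: "lin (\<lambda>v. v)"
  unfolding Vector_Spaces.linear_iff
  by (simp_all add: vector_space_axioms scale_expand algebra_simps)

lemma subspace_vimage: "lin f \<Longrightarrow> subspace S \<Longrightarrow> subspace {v. f v \<in> S}"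
  unfolding subspace_def by (simp add: lin_simps)

lemma subspace_diff_scaled:
  assumes "subspace S" "w - c *s v \<in> S" "v \<in> S"
  shows "w \<in> S"
  using subspace_add[OF assms(1,2) subspace_scale[OF assms(1,3), of c]] by simp

lemma lin_inv:
  assumes "lin f" "bij f"
  shows "lin (inv_into UNIV f)"
proof -
  let ?g = "inv_into UNIV f"
  have fg: "f (?g v) = v" for v using assms(2) by (simp add: bij_is_surj surj_f_inv_f)
  have eq: "f x = f y \<Longrightarrow> x = y" for x y using assms(2) by (simp add: bij_is_inj inj_eq)
  show ?thesis unfolding Vector_Spaces.linear_iff
  proof (intro conjI allI vector_space_axioms)
    show "?g (x + y) = ?g x + ?g y" for x y
      by (rule eq) (simp add: fg lin_simps[OF assms(1)])
    show "?g (c *s x) = c *s ?g x" for c x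
      by (rule eq) (simp add: fg lin_simps[OF assms(1)])
  qed
qed

lemma subspace_set_sum:
  assumes "finite I" "\<And>i. i \<in> I \<Longrightarrow> subspace (W i)"
  shows "subspace (\<Sum>i\<in>I. W i)"
  using assms
proof (induction I rule: finite_induct)
  case empty
  then show ?case by simp
next
  case (insert i I)
  moreover have "W i + (\<Sum>i\<in>I. W i) = {x + y |x y. x \<in> W i \<and> y \<in> (\<Sum>i\<in>I. W i)}"
    by (auto simp: set_plus_def)
  ultimately show ?case using subspace_sums[of "W i" "\<Sum>i\<in>I. W i"] by simp
qed

lemma set_sum_subset:
  assumes "finite I" "subspace S" "\<And>i. i \<in> I \<Longrightarrow> W i \<subseteq> S"
  shows "(\<Sum>i\<in>I. W i) \<subseteq> S"
  using assms(2,3) unfolding set_sum_alt[OF assms(1)] by (auto intro!: subspace_sum)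

lemma subset_set_sum:
  assumes "finite I" "\<And>i. i \<in> I \<Longrightarrow> subspace (W i)" "i \<in> I"
  shows "W i \<subseteq> (\<Sum>i\<in>I. W i)"
proof
  fix v assume v: "v \<in> W i"
  have "v = (\<Sum>j\<in>I. if j = i then v else 0)" using assms by simp
  moreover have "\<forall>j\<in>I. (if j = i then v else 0) \<in> W j" using assms v by (simp add: subspace_0)
  ultimately show "v \<in> (\<Sum>i\<in>I. W i)" unfolding set_sum_alt[OF assms(1)] by blast
qed

lemma set_sum_mono:
  assumes "finite J" "I \<subseteq> J" "\<And>i. i \<in> J \<Longrightarrow> subspace (W i)"
  shows "(\<Sum>i\<in>I. W i) \<subseteq> (\<Sum>i\<in>J. W i)"
  using assms by (intro set_sum_subset subspace_set_sum subset_set_sum) (auto intro: finite_subset)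

section \<open>Equitable triples from three linear relations\<close>

lemma End_ring_inverse:
  assumes "lin f" "lin g" "\<And>v. f (g v) = v" "\<And>v. g (f v) = v"
  shows "f \<in> Units (End_ring scale)" "inv\<^bsub>End_ring scale\<^esub> f = g"
proof -
  have m: "Group.monoid (End_ring scale)"
  proof (rule Group.monoidI)
    fix f g assume "f \<in> carrier (End_ring scale)" "g \<in> carrier (End_ring scale)"
    then show "f \<otimes>\<^bsub>End_ring scale\<^esub> g \<in> carrier (End_ring scale)"
      using lin_comp by (simp add: End_ring_def comp_def)
  qed (use lin_ident in \<open>auto simp: End_ring_def id_def\<close>)
  show "f \<in> Units (End_ring scale)"
    using assms unfolding Units_def by (auto simp: End_ring_def fun_eq_iff intro!: bexI[of _ g])
  show "inv\<^bsub>End_ring scale\<^esub> f = g"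
    by (rule monoid.inv_unique'[OF m, symmetric]) (use assms in \<open>auto simp: End_ring_def fun_eq_iff\<close>)
qed

text \<open>Multiplying the relations between \<open>M\<close> and the outer members by \<open>M\<^sup>-\<^sup>1\<close> on both sides turns
  them into relations for \<open>M\<^sup>-\<^sup>1\<close>. In this form no inverse has to be handled, and the powers of
  \<open>q\<close> are even, which keeps later computations polynomial.\<close>

lemma equitable_tripleI:
  assumes q: "q \<noteq> 0" "q\<^sup>2 \<noteq> 1"
    and lin: "lin X" "lin M" "lin Z" and bij: "bij X" "bij M" "bij Z"
    and ZX: "\<And>v. q\<^sup>2 *s Z (X v) - X (Z v) = (q\<^sup>2 - 1) *s v"
    and ZM: "\<And>v. q\<^sup>2 *s Z (M v) - M (Z v) = (q\<^sup>2 - 1) *s M (M v)"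
    and MX: "\<And>v. q\<^sup>2 *s M (X v) - X (M v) = (q\<^sup>2 - 1) *s M (M v)"
  shows "equitable_triple scale q X (inv\<^bsub>End_ring scale\<^esub> M) Z"
proof -
  define Y where "Y = inv_into UNIV M"
  have Y: "lin Y" "\<And>v. M (Y v) = v" "\<And>v. Y (M v) = v"
    using lin(2) bij(2) by (simp_all add: Y_def lin_inv bij_is_surj surj_f_inv_f bij_is_inj)
  have inv_M: "inv\<^bsub>End_ring scale\<^esub> M = Y" and unit_Y: "Y \<in> Units (End_ring scale)"
    using End_ring_inverse[OF lin(2) Y] End_ring_inverse[OF Y(1) lin(2) Y(3,2)] by auto
  have unit: "f \<in> Units (End_ring scale)" if "lin f" "bij f" for f
    using that by (intro End_ring_inverse(1)[OF that(1) lin_inv[OF that]]) (simp_all add: bij_is_surj surj_f_inv_f bij_is_inj)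
  have normalise: "(1 / (q - inverse q)) *s (q *s u - inverse q *s w) = v"
    if "q\<^sup>2 *s u - w = (q\<^sup>2 - 1) *s v" for u v w
  proof -
    have nz: "q - inverse q \<noteq> 0" using q by (simp add: field_simps power2_eq_square)
    have "q *s u - inverse q *s w = inverse q *s (q\<^sup>2 *s u - w)"
      using q(1) by (simp add: scale_right_diff_distrib power2_eq_square mult.assoc[symmetric])
    also have "\<dots> = (q - inverse q) *s v"
    proof -
      have "inverse q * (q\<^sup>2 - 1) = q - inverse q" using q(1) by (simp add: field_simps power2_eq_square)
      then show ?thesis by (simp add: that)
    qed
    finally show ?thesis using nz by simp
  qed
  show ?thesis unfolding equitable_triple_def inv_M
  proof (intro conjI allI normalise ZX unit_Y unit[OF lin(1) bij(1)] unit[OF lin(3) bij(3)])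
    fix v
    show "q\<^sup>2 *s X (Y v) - Y (X v) = (q\<^sup>2 - 1) *s v"
      using arg_cong[OF MX[of "Y v"], of Y] Y(1) by (simp add: lin_simps Y(2,3))
    show "q\<^sup>2 *s Y (Z v) - Z (Y v) = (q\<^sup>2 - 1) *s v"
      using arg_cong[OF ZM[of "Y v"], of Y] Y(1) by (simp add: lin_simps Y(2,3))
  qed
qed

lemma scale_difference_quotient: "(1 / (x - y)) *s (u - w) = (1 / (y - x)) *s (w - u)"
proof -
  have "1 / (x - y) = - (1 / (y - x))" by (metis minus_diff_eq minus_divide_right)
  moreover have "u - w = - (w - u)" by simp
  ultimately show ?thesis by (simp only: scale_minus_left scale_minus_right minus_minus)
qed

text \<open>This symmetry relates the triples that contain \<open>K\<close> and \<open>B\<close> to those that contain their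
  inverses.\<close>

lemma equitable_triple_inverse:
  assumes "equitable_triple scale (inverse q) X Y Z"
  shows "equitable_triple scale q Z Y X"
proof -
  have "(1 / (inverse q - q)) *s (u - w) = (1 / (q - inverse q)) *s (w - u)" for u w
    by (rule scale_difference_quotient)
  with assms show ?thesis unfolding equitable_triple_def by simp
qed

section \<open>The quadratic relation as an operator identity\<close>

text \<open>The commutation rule that \<open>K\<close> and \<open>B\<close> share, with free coefficients: moving \<open>A\<close> past two
  such maps one at a time gives the rule for their product. The four products of \<open>K\<close> and \<open>B\<close> are
  all instances.\<close>

lemma raising_product:
  assumes "lin A" "lin S" "lin T"
    and S: "\<And>v. p *s S (A v) = A (S v) + (p - 1) *s (x *s S (S v) + y *s v)"
    and T: "\<And>v. p *s T (A v) = A (T v) + (p - 1) *s (z *s T (T v) + w *s v)"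
  shows "p\<^sup>2 *s S (T (A v)) = A (S (T v)) + (p - 1) *s (x *s S (S (T v)) + y *s T v)
    + (p * (p - 1)) *s (z *s S (T (T v)) + w *s S v)"
proof -
  have "p\<^sup>2 *s S (T (A v)) = p *s S (p *s T (A v))"
    using assms(1-3) by (simp add: lin_simps power2_eq_square)
  also have "\<dots> = p *s S (A (T v)) + (p * (p - 1)) *s (z *s S (T (T v)) + w *s S v)"
    unfolding T using assms(1-3) by (simp add: lin_simps scale_right_distrib mult.assoc)
  finally show ?thesis by (simp only: S)
qed

text \<open>The same for \<open>A\<^sup>*\<close>, which moves past \<open>K\<close> and \<open>B\<close> in the opposite direction.\<close>

lemma lowering_product:
  assumes "lin A" "lin S" "lin T"
    and S: "\<And>v. p *s A (S v) = S (A v) + (p - 1) *s (x *s S (S v) + y *s v)"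
    and T: "\<And>v. p *s A (T v) = T (A v) + (p - 1) *s (z *s T (T v) + w *s v)"
  shows "p\<^sup>2 *s A (S (T v)) = S (T (A v)) + (p - 1) *s (z *s S (T (T v)) + w *s S v)
    + (p * (p - 1)) *s (x *s S (S (T v)) + y *s T v)"
proof -
  have "p\<^sup>2 *s A (S (T v)) = p *s (p *s A (S (T v)))"
    by (simp add: power2_eq_square)
  also have "\<dots> = S (p *s A (T v)) + (p * (p - 1)) *s (x *s S (S (T v)) + y *s T v)"
    unfolding S using assms(1-3) by (simp add: lin_simps scale_right_distrib mult.assoc)
  also have "S (p *s A (T v)) = S (T (A v)) + (p - 1) *s (z *s S (T (T v)) + w *s S v)"
    unfolding T using assms(1-3) by (simp add: lin_simps scale_right_distrib mult.assoc)
  finally show ?thesis .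
qed

text \<open>With \<open>p = q\<^sup>2\<close> and \<open>c = a\<^sup>2\<close>, a nonzero multiple of \<open>aK\<^sup>2 - (a\<^sup>-\<^sup>1q - aq\<^sup>-\<^sup>1)/(q - q\<^sup>-\<^sup>1) KB
  - (aq - a\<^sup>-\<^sup>1q\<^sup>-\<^sup>1)/(q - q\<^sup>-\<^sup>1) BK + a\<^sup>-\<^sup>1B\<^sup>2\<close>. Denominators are cleared so that identities
  between such operators can be checked by comparing polynomial coefficients.\<close>

definition KB_quadratic :: "'f \<Rightarrow> 'f \<Rightarrow> ('v \<Rightarrow> 'v) \<Rightarrow> ('v \<Rightarrow> 'v) \<Rightarrow> 'v \<Rightarrow> 'v" where
  "KB_quadratic p c K B v = (c * (p - 1)) *s K (K v) - (p - c) *s K (B v)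
     - (c * p - 1) *s B (K v) + (p - 1) *s B (B v)"

text \<open>In \<open>p\<^sup>2QA - AQ\<close> the terms linear in \<open>K\<close> and \<open>B\<close> cancel, and the cubic ones regroup as left
  and right multiples of \<open>Q\<close>. The map called \<open>A\<close> here is \<open>a\<close> times the generator, and the
  coefficient \<open>1\<close> is written out so that the two hypotheses have the shape used for products.\<close>

lemma quadratic_raising:
  assumes lin: "lin A" "lin K" "lin B"
    and K: "\<And>v. p *s K (A v) = A (K v) + (p - 1) *s (c *s K (K v) + 1 *s v)"
    and B: "\<And>v. p *s B (A v) = A (B v) + (p - 1) *s (1 *s B (B v) + c *s v)"
  defines "Q \<equiv> KB_quadratic p c K B"
  shows "(1 - c) *s (p\<^sup>2 *s Q (A v) - A (Q v)) = (p - 1) *s ((c * (p - c)) *s K (Q v)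
     - (c * (c * p - 1)) *s Q (K v) - (c * p - 1) *s B (Q v) + (p - c) *s Q (B v))"
proof -
  have "p\<^sup>2 *s Q (A v) = (c * (p - 1)) *s (p\<^sup>2 *s K (K (A v))) - (p - c) *s (p\<^sup>2 *s K (B (A v)))
     - (c * p - 1) *s (p\<^sup>2 *s B (K (A v))) + (p - 1) *s (p\<^sup>2 *s B (B (A v)))"
    by (simp only: Q_def KB_quadratic_def scale_right_distrib scale_right_diff_distrib scale_scale mult.commute)
  note 1 = this[unfolded raising_product[OF lin(1,2,2) K K] raising_product[OF lin(1,2,3) K B]
     raising_product[OF lin(1,3,2) B K] raising_product[OF lin(1,3,3) B B]]
  show ?thesis unfolding 1
    by (simp add: Q_def KB_quadratic_def lin[THEN lin_simps(1)] lin[THEN lin_simps(2)] lin[THEN lin_simps(5)]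
        scale_expand algebra_simps)
qed

text \<open>The counterpart for \<open>A\<^sup>*\<close>, rescaled by the parameter of its eigenvalues; \<open>e\<close> is the square
  of that parameter.\<close>

lemma quadratic_lowering:
  fixes c :: 'f
  assumes lin: "lin A" "lin K" "lin B"
    and K: "\<And>v. p *s A (K v) = K (A v) + (p - 1) *s (e *s K (K v) + 1 *s v)"
    and B: "\<And>v. p *s A (B v) = B (A v) + (p - 1) *s (e *s B (B v) + 1 *s v)"
  defines "Q \<equiv> KB_quadratic p c K B"
  shows "(1 - c) *s (p\<^sup>2 *s A (Q v) - Q (A v)) = (e * (p - 1)) *s ((p - c) *s (K (Q v) + Q (B v))
     - (c * p - 1) *s (Q (K v) + B (Q v)))"
proof -
  have "p\<^sup>2 *s A (Q v) = (c * (p - 1)) *s (p\<^sup>2 *s A (K (K v))) - (p - c) *s (p\<^sup>2 *s A (K (B v)))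
     - (c * p - 1) *s (p\<^sup>2 *s A (B (K v))) + (p - 1) *s (p\<^sup>2 *s A (B (B v)))"
    using lin(1) by (simp add: Q_def KB_quadratic_def lin_simps scale_right_distrib scale_right_diff_distrib mult.commute)
  note 1 = this[unfolded lowering_product[OF lin(1,2,2) K K] lowering_product[OF lin(1,2,3) K B]
     lowering_product[OF lin(1,3,2) B K] lowering_product[OF lin(1,3,3) B B]]
  show ?thesis unfolding 1
    by (simp add: Q_def KB_quadratic_def lin[THEN lin_simps(1)] lin[THEN lin_simps(2)] lin[THEN lin_simps(5)]
        scale_expand algebra_simps)
qed

lemma lin_quadratic:
  assumes K: "lin K" and B: "lin B"
  shows "lin (KB_quadratic p c K B)"
  unfolding KB_quadratic_def
  by (intro lin_plus lin_diff lin_scaled lin_comp[OF K K] lin_comp[OF K B] lin_comp[OF B K] lin_comp[OF B B])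

text \<open>\<open>W\<close> is the largest subspace of the kernel of \<open>Q\<close> that is stable under \<open>\<S>\<close>, described by
  words in \<open>\<S>\<close>. If the members of \<open>\<S>\<close> can be moved past \<open>T\<close> up to terms in \<open>\<S>\<close> alone, then \<open>TW +
  W\<close> is stable under \<open>\<S>\<close>; if moreover \<open>Q\<close> kills \<open>TW\<close>, maximality gives \<open>TW \<subseteq> W\<close>.\<close>

lemma kernel_core_invariant:
  assumes lin: "lin T" "lin Q" and S_lin: "\<And>S. S \<in> \<S> \<Longrightarrow> lin S"
    and comm: "\<And>S v. S \<in> \<S> \<Longrightarrow> \<exists>x y z. S (T v) = x *s T (S v) + (y *s S (S v) + z *s v)"
    and Q: "\<And>v. Q v = 0 \<Longrightarrow> (\<And>S. S \<in> \<S> \<Longrightarrow> Q (S v) = 0) \<Longrightarrow> Q (T v) = 0"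
  defines "W \<equiv> {v. \<forall>Ss\<in>lists \<S>. Q (fold (\<lambda>S. S) Ss v) = 0}"
  shows "subspace W" "T ` W \<subseteq> W"
proof -
  have fold_lin: "lin (fold (\<lambda>S. S) Ss)" if "Ss \<in> lists \<S>" for Ss
    using that
  proof induction
    case Nil
    then show ?case using lin_ident by (simp add: id_def)
  next
    case (Cons S Ss)
    then show ?case using lin_comp[OF _ S_lin] by (simp add: comp_def)
  qed
  show W: "subspace W"
    unfolding subspace_def W_def by (auto simp: lin_simps[OF fold_lin] lin_simps[OF lin(2)])
  have SW: "S v \<in> W" if "S \<in> \<S>" "v \<in> W" for S v
  proof -
    have "Q (fold (\<lambda>S. S) Ss (S v)) = 0" if "Ss \<in> lists \<S>" for Ss
    proof -
      have "S # Ss \<in> lists \<S>" using that \<open>S \<in> \<S>\<close> by simp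
      then have "Q (fold (\<lambda>S. S) (S # Ss) v) = 0" using \<open>v \<in> W\<close> unfolding W_def by blast
      then show ?thesis by simp
    qed
    then show ?thesis by (simp add: W_def)
  qed
  have QW: "Q v = 0" if "v \<in> W" for v
    using that unfolding W_def by (auto dest: bspec[of _ _ "[]"])
  have "Q (fold (\<lambda>S. S) Ss (x *s T v + u)) = 0" if "Ss \<in> lists \<S>" "v \<in> W" "u \<in> W" for Ss x v u
    using that
  proof (induction arbitrary: x v u)
    case Nil
    then show ?case using Q QW SW by (simp add: lin_simps[OF lin(2)])
  next
    case (Cons S Ss)
    obtain x' y z where xyz: "S (T v) = x' *s T (S v) + (y *s S (S v) + z *s v)"
      using comm[OF Cons.hyps(1)] by blast
    have "S (x *s T v + u) = (x * x') *s T (S v) + (x *s (y *s S (S v) + z *s v) + S u)"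
      using Cons.hyps(1) by (simp add: lin_simps[OF S_lin] xyz scale_right_distrib add.assoc)
    moreover have "x *s (y *s S (S v) + z *s v) + S u \<in> W"
      using SW[OF Cons.hyps(1) SW[OF Cons.hyps(1) Cons.prems(1)]] SW[OF Cons.hyps(1) Cons.prems(2)] Cons.prems(1)
      by (intro subspace_add[OF W] subspace_scale[OF W])
    ultimately show ?case using Cons.IH[OF SW[OF Cons.hyps(1) Cons.prems(1)]] by simp
  qed
  note * = this
  show "T ` W \<subseteq> W"
  proof (rule image_subsetI)
    fix v assume v: "v \<in> W"
    have "Q (fold (\<lambda>S. S) Ss (T v)) = 0" if "Ss \<in> lists \<S>" for Ss
      using *[OF that v subspace_0[OF W], of 1] by simp
    then show "T v \<in> W" by (simp add: W_def)
  qed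
qed

text \<open>The core of the kernel of \<open>Q\<close> is invariant under both generators by the two identities
  above, and it contains \<open>E\<close>, on which \<open>Q\<close> acts as \<open>t\<^sup>2\<close> times the sum of its coefficients, which
  is zero.\<close>

lemma quadratic_vanishes:
  assumes lin: "lin A" "lin As" "lin K" "lin B" and c: "c \<noteq> 1" and p: "p \<noteq> 0"
    and KA: "\<And>v. p *s K (A v) = A (K v) + (p - 1) *s (c *s K (K v) + 1 *s v)"
    and BA: "\<And>v. p *s B (A v) = A (B v) + (p - 1) *s (1 *s B (B v) + c *s v)"
    and KAs: "\<And>v. p *s As (K v) = K (As v) + (p - 1) *s (e *s K (K v) + 1 *s v)"
    and BAs: "\<And>v. p *s As (B v) = B (As v) + (p - 1) *s (e *s B (B v) + 1 *s v)"
    and irreducible: "\<And>W. subspace W \<Longrightarrow> A ` W \<subseteq> W \<Longrightarrow> As ` W \<subseteq> W \<Longrightarrow> W = {0} \<or> W = UNIV"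
    and E: "subspace E" "E \<noteq> {0}" "\<And>v. v \<in> E \<Longrightarrow> K v = t *s v" "\<And>v. v \<in> E \<Longrightarrow> B v = t *s v"
  shows "KB_quadratic p c K B v = 0"
proof -
  define Q where "Q = KB_quadratic p c K B"
  have Q: "lin Q" unfolding Q_def using lin(3,4) by (rule lin_quadratic)
  define W where "W = {v. \<forall>Ss\<in>lists {K, B}. Q (fold (\<lambda>S. S) Ss v) = 0}"
  \<comment> \<open>Brings the relations for \<open>A\<close> into the form in which a member of \<open>{K, B}\<close> is moved past \<open>A\<close>.\<close>
  have solve: "w = (1 / p) *s r" if "p *s w = r" for w r
    using p by (simp add: that[symmetric])
  have inv_A: "subspace W" "A ` W \<subseteq> W"
  proof -
    have comm: "\<exists>x y z. S (A v) = x *s A (S v) + (y *s S (S v) + z *s v)" if S: "S \<in> {K, B}" for S v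
    proof -
      obtain y z where "p *s S (A v) = A (S v) + (p - 1) *s (y *s S (S v) + z *s v)"
        using S KA[of v] BA[of v] by blast
      from solve[OF this] show ?thesis
        unfolding scale_right_distrib scale_scale by blast
    qed
    have QA: "Q (A v) = 0" if "Q v = 0" "\<And>S. S \<in> {K, B} \<Longrightarrow> Q (S v) = 0" for v
      using quadratic_raising[OF lin(1,3,4) KA BA, of v] that c p lin
      by (simp add: Q_def[symmetric] lin_simps)
    show "subspace W" "A ` W \<subseteq> W"
      unfolding W_def using kernel_core_invariant[OF lin(1) Q, of "{K, B}"] comm QA lin by blast+
  qed
  have inv_As: "As ` W \<subseteq> W"
  proof -
    have comm: "\<exists>x y z. S (As v) = x *s As (S v) + (y *s S (S v) + z *s v)" if S: "S \<in> {K, B}" for S v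
    proof -
      obtain y z where "p *s As (S v) = S (As v) + (p - 1) *s (y *s S (S v) + z *s v)"
        using S KAs[of v] BAs[of v] by blast
      then have "S (As v) = p *s As (S v) + ((- (p - 1) * y) *s S (S v) + (- (p - 1) * z) *s v)"
        by (simp add: scale_expand algebra_simps)
      then show ?thesis by blast
    qed
    have QA: "Q (As v) = 0" if "Q v = 0" "\<And>S. S \<in> {K, B} \<Longrightarrow> Q (S v) = 0" for v
      using quadratic_lowering[OF lin(2,3,4) KAs BAs, of c v] that c lin
      by (simp add: Q_def[symmetric] lin_simps)
    show "As ` W \<subseteq> W"
      unfolding W_def using kernel_core_invariant[OF lin(2) Q, of "{K, B}"] comm QA lin by blast
  qed
  have QE: "Q v = 0" if "v \<in> E" for v
  proof -
    have "t *s v \<in> E" using E(1) that by (rule subspace_scale)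
    then have "Q v = (c * (p - 1) - (p - c) - (c * p - 1) + (p - 1)) *s t *s t *s v"
      unfolding Q_def KB_quadratic_def scale_left_distrib scale_left_diff_distrib
        by (simp only: E that lin_simps lin)
    also have "c * (p - 1) - (p - c) - (c * p - 1) + (p - 1) = 0" by (simp add: algebra_simps)
    finally show ?thesis by simp
  qed
  have "fold (\<lambda>S. S) Ss v \<in> E" if "Ss \<in> lists {K, B}" "v \<in> E" for Ss v
    using that by (induction arbitrary: v) (auto simp: E subspace_scale)
  then have "E \<subseteq> W" using QE by (auto simp: W_def)
  then have "W = UNIV" using irreducible[OF inv_A inv_As] E(2) subspace_0[OF E(1)] by auto
  then have "v \<in> W" by simp
  then show ?thesis by (auto simp: W_def Q_def dest: bspec[of _ _ "[]"])
qed

text \<open>With \<open>L = cK - B\<close>, the operator \<open>(c - 1)(pKL - LK)\<close> equals \<open>(p - 1)L\<^sup>2 - Q\<close>, and \<open>(c -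
  1)(pLX - XL)\<close> equals \<open>(p - 1)L\<^sup>2 - cQ\<close>. So both relations for \<open>M = L/(c - 1)\<close> follow from \<open>Q =
  0\<close>, while the relation between \<open>X\<close> and \<open>K\<close> is a rewriting of the hypothesis on \<open>K\<close>.\<close>

lemma relations_of_quadratic:
  assumes lin: "lin A" "lin K" "lin B" and KB_quadratic: "\<And>v. KB_quadratic p c K B v = 0" and c: "c \<noteq> 1"
    and KA: "\<And>v. p *s K (A v) = A (K v) + (p - 1) *s (c *s K (K v) + 1 *s v)"
    and BA: "\<And>v. p *s B (A v) = A (B v) + (p - 1) *s (1 *s B (B v) + c *s v)"
  defines "X \<equiv> \<lambda>v. A v - c *s K v" and "M \<equiv> \<lambda>v. (1 / (c - 1)) *s (c *s K v - B v)"
  shows "p *s K (X v) - X (K v) = (p - 1) *s v"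
    and "p *s K (M v) - M (K v) = (p - 1) *s M (M v)"
    and "p *s M (X v) - X (M v) = (p - 1) *s M (M v)"
proof -
  define L where "L v = c *s K v - B v" for v
  define m where "m = 1 / (c - 1)"
  have m: "m * (c - 1) = 1" using c by (simp add: m_def)
  note ls = lin[THEN lin_simps(1)] lin[THEN lin_simps(2)] lin[THEN lin_simps(5)]
  have X: "lin X" unfolding X_def using lin by (intro lin_diff lin_scaled)
  have L: "lin L" unfolding L_def[abs_def] using lin by (intro lin_diff lin_scaled)
  have M: "M v = m *s L v" for v by (simp add: M_def L_def m_def)
  have MM: "M (M v) = (m * m) *s L (L v)" for v by (simp add: M lin_simps[OF L])
  show "p *s K (X v) - X (K v) = (p - 1) *s v"
    unfolding X_def by (simp add: ls scale_right_diff_distrib KA) (simp add: scale_expand algebra_simps)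
  have "(c - 1) *s (p *s K (L v) - L (K v)) = (p - 1) *s L (L v) - KB_quadratic p c K B v"
    unfolding L_def KB_quadratic_def by (simp add: ls scale_expand algebra_simps)
  then have 1: "(c - 1) *s (p *s K (L v) - L (K v)) = (p - 1) *s L (L v)" by (simp add: KB_quadratic)
  have "p *s K (M v) - M (K v) = (m * (m * (c - 1))) *s (p *s K (L v) - L (K v))"
    by (simp add: M m lin_simps[OF lin(2)] scale_right_diff_distrib mult.commute)
  also have "\<dots> = (m * m) *s (c - 1) *s (p *s K (L v) - L (K v))" by (simp only: scale_scale mult.assoc)
  also have "\<dots> = (p - 1) *s M (M v)" unfolding 1 MM by (simp add: mult.commute)
  finally show "p *s K (M v) - M (K v) = (p - 1) *s M (M v)" .
  have "p *s L (X v) - X (L v) = c *s (p *s K (A v)) - p *s B (A v) - (A (L v) + (c * p) *s L (K v) - c *s K (L v))"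
    unfolding L_def X_def by (simp add: ls scale_expand algebra_simps)
  also have "\<dots> = (c * p) *s B (K v) - c *s K (B v) - (p - 1) *s B (B v)"
    unfolding KA BA unfolding L_def by (simp add: ls scale_expand algebra_simps)
  finally have LX: "p *s L (X v) - X (L v) = (c * p) *s B (K v) - c *s K (B v) - (p - 1) *s B (B v)" .
  have "(c - 1) *s (p *s L (X v) - X (L v)) = (p - 1) *s L (L v) - c *s KB_quadratic p c K B v"
    unfolding LX by (simp add: L_def KB_quadratic_def ls scale_expand algebra_simps)
  then have 2: "(c - 1) *s (p *s L (X v) - X (L v)) = (p - 1) *s L (L v)" by (simp add: KB_quadratic)
  have "p *s M (X v) - X (M v) = (m * (m * (c - 1))) *s (p *s L (X v) - X (L v))"
    by (simp add: M m lin_simps[OF X] scale_right_diff_distrib mult.commute)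
  also have "\<dots> = (m * m) *s (c - 1) *s (p *s L (X v) - X (L v))" by (simp only: scale_scale mult.assoc)
  also have "\<dots> = (p - 1) *s M (M v)" unfolding 2 MM by (simp add: mult.commute)
  finally show "p *s M (X v) - X (M v) = (p - 1) *s M (M v)" .
qed

section \<open>Flags and the split decomposition\<close>

text \<open>A flag on which \<open>X\<close> is triangular with diagonal \<open>\<mu>\<close> and which \<open>Y\<close> raises by at most one
  step. The indices are shifted by one, so that the zero subspace has index \<open>0\<close> and the diagonal
  entry \<open>\<mu> n\<close> belongs to the quotient of \<open>F (Suc n)\<close> by \<open>F n\<close>.\<close>

definition eigenflag :: "nat \<Rightarrow> ('v \<Rightarrow> 'v) \<Rightarrow> (nat \<Rightarrow> 'f) \<Rightarrow> ('v \<Rightarrow> 'v) \<Rightarrow> (nat \<Rightarrow> 'v set) \<Rightarrow> bool" where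
  "eigenflag d X \<mu> Y F \<longleftrightarrow>
     (\<forall>n. subspace (F n)) \<and> F 0 = {0} \<and> F 1 \<noteq> {0} \<and> F (Suc d) = UNIV \<and>
     (\<forall>n\<le>d. F n \<noteq> UNIV \<and> F n \<subseteq> F (Suc n) \<and>
        (\<forall>v\<in>F (Suc n). X v - \<mu> n *s v \<in> F n) \<and> (\<forall>v\<in>F n. Y v \<in> F (Suc n)))"

lemma eigenflag_mono:
  assumes "eigenflag d X \<mu> Y F" "m \<le> n" "n \<le> Suc d"
  shows "F m \<subseteq> F n"
  using assms(2,3)
proof (induction n rule: dec_induct)
  case (step n)
  then have "F n \<subseteq> F (Suc n)" using assms(1) by (simp add: eigenflag_def)
  with step show ?case by auto
qed simp

text \<open>A vector of the kernel drops from each member of the flag to the one below it, hence is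
  zero; a preimage of \<open>v\<close> is obtained from one of \<open>T v - \<tau> n *s v\<close>, which lies one member lower.\<close>

lemma triangular_bij:
  assumes "lin T" and sub: "\<And>n. subspace (F n)" and F: "F 0 = {0}" "F (Suc d) = UNIV"
    and T: "\<And>n v. n \<le> d \<Longrightarrow> v \<in> F (Suc n) \<Longrightarrow> T v - \<tau> n *s v \<in> F n"
    and nz: "\<And>n. n \<le> d \<Longrightarrow> \<tau> n \<noteq> 0"
  shows "bij T"
proof -
  have inj: "v = 0" if "n \<le> Suc d" "v \<in> F n" "T v = 0" for n v
    using that
  proof (induction n)
    case 0
    then show ?case by (simp add: F)
  next
    case (Suc n)
    then have "T v - \<tau> n *s v \<in> F n" by (intro T) auto
    then have "(- 1 / \<tau> n) *s (T v - \<tau> n *s v) \<in> F n" by (rule subspace_scale[OF sub])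
    then show ?case using Suc nz[of n] by simp
  qed
  have surj: "\<exists>u. T u = v" if "n \<le> Suc d" "v \<in> F n" for n v
    using that
  proof (induction n arbitrary: v)
    case 0
    then show ?case using assms(1) lin_simps(4) by (auto simp: F)
  next
    case (Suc n)
    then obtain u where u: "T u = T v - \<tau> n *s v" using T by fastforce
    have "T ((1 / \<tau> n) *s (v - u)) = v"
      using Suc.prems nz[of n] by (simp add: lin_simps[OF assms(1)] u)
    then show ?case by blast
  qed
  have "inj T"
  proof (rule injI)
    fix u v assume "T u = T v"
    then have "T (u - v) = 0" by (simp add: lin_simps[OF assms(1)])
    then show "u = v" using inj[of "Suc d" "u - v"] by (simp add: F)
  qed
  moreover have "surj T" using surj[of "Suc d"] F(2) by (metis UNIV_I le_refl surj_def)
  ultimately show ?thesis by (simp add: bij_def)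
qed

end

text \<open>Both flags are increasing, and \<open>X\<close> and \<open>Y\<close> play symmetric roles, so that every statement
  about \<open>F\<close> has a mirror image about \<open>G\<close>. In the application \<open>X\<close> is \<open>A\<^sup>*\<close> and \<open>Y\<close> is \<open>A\<close>.\<close>

locale split_decomposition = linear_algebra scale
  for scale :: "'f::field \<Rightarrow> 'v::ab_group_add \<Rightarrow> 'v" (infixr "*s" 75) +
  fixes d :: nat and X Y :: "'v \<Rightarrow> 'v" and \<mu> \<eta> :: "nat \<Rightarrow> 'f" and F G :: "nat \<Rightarrow> 'v set"
  assumes X: "lin X" and Y: "lin Y"
    and F: "eigenflag d X \<mu> Y F" and G: "eigenflag d Y \<eta> X G"
    and irreducible: "\<And>W. subspace W \<Longrightarrow> X ` W \<subseteq> W \<Longrightarrow> Y ` W \<subseteq> W \<Longrightarrow> W = {0} \<or> W = UNIV"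
begin

definition U :: "nat \<Rightarrow> 'v set" where "U i = F (Suc i) \<inter> G (Suc d - i)"

lemma swap: "split_decomposition scale d Y X \<eta> \<mu> G F"
  by (intro split_decomposition.intro split_decomposition_axioms.intro linear_algebra_axioms Y X G F)
    (rule irreducible)

lemma subspace_F: "subspace (F n)" and subspace_G: "subspace (G n)"
  using F G by (simp_all add: eigenflag_def)

lemma subspace_U: "subspace (U i)"
  unfolding U_def by (rule subspace_inter[OF subspace_F subspace_G])

lemma F_step:
  assumes "n \<le> d"
  shows "v \<in> F (Suc n) \<Longrightarrow> X v - \<mu> n *s v \<in> F n" "v \<in> F n \<Longrightarrow> Y v \<in> F (Suc n)" "F n \<subseteq> F (Suc n)" "F n \<noteq> UNIV"
  using F assms by (auto simp: eigenflag_def)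

lemma G_step:
  assumes "n \<le> d"
  shows "v \<in> G (Suc n) \<Longrightarrow> Y v - \<eta> n *s v \<in> G n" "v \<in> G n \<Longrightarrow> X v \<in> G (Suc n)" "G n \<subseteq> G (Suc n)"
  using G assms by (auto simp: eigenflag_def)

lemma F_G_ends: "F 0 = {0}" "F (Suc d) = UNIV" "G 0 = {0}" "G (Suc d) = UNIV" "F 1 \<noteq> {0}"
  using F G by (simp_all add: eigenflag_def)

lemma invariant_set_sum_trivial:
  assumes I: "finite I" and P: "\<And>i. i \<in> I \<Longrightarrow> subspace (P i)"
    and inv: "\<And>i v. i \<in> I \<Longrightarrow> v \<in> P i \<Longrightarrow> X v \<in> (\<Sum>i\<in>I. P i) \<and> Y v \<in> (\<Sum>i\<in>I. P i)"
  shows "(\<Sum>i\<in>I. P i) = {0} \<or> (\<Sum>i\<in>I. P i) = UNIV"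
proof (rule irreducible)
  let ?S = "\<Sum>i\<in>I. P i"
  show S: "subspace ?S" using I P by (rule subspace_set_sum)
  show "X ` ?S \<subseteq> ?S" using set_sum_subset[OF I subspace_vimage[OF X S], of P] inv by blast
  show "Y ` ?S \<subseteq> ?S" using set_sum_subset[OF I subspace_vimage[OF Y S], of P] inv by blast
qed

text \<open>The sum \<open>S\<close> of these intersections over all \<open>i\<close> is invariant: up to a scalar multiple of the
  vector, \<open>X\<close> lowers the index in \<open>F\<close> and raises the one in \<open>G\<close>, and \<open>Y\<close> does the reverse. Since
  \<open>S\<close> lies in the proper subspace \<open>F d\<close>, it is zero.\<close>

lemma F_Int_G:
  assumes "i \<le> Suc d"
  shows "F i \<inter> G (Suc d - i) = {0}"
proof -
  define P where "P i = F i \<inter> G (Suc d - i)" for i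
  let ?S = "\<Sum>i\<le>Suc d. P i"
  have P: "subspace (P i)" for i unfolding P_def by (rule subspace_inter[OF subspace_F subspace_G])
  have S: "subspace ?S" by (rule subspace_set_sum) (simp_all add: P)
  have PS: "P i \<subseteq> ?S" if "i \<le> Suc d" for i using that by (intro subset_set_sum) (auto simp: P)
  have P_ends: "P 0 = {0}" "P (Suc d) = {0}"
    using subspace_0[OF subspace_G] subspace_0[OF subspace_F] by (auto simp: P_def F_G_ends)
  have "?S \<subseteq> F d"
  proof (rule set_sum_subset[OF _ subspace_F])
    fix i assume "i \<in> {..Suc d}"
    then show "P i \<subseteq> F d"
      using P_ends subspace_0[OF subspace_F] eigenflag_mono[OF F, of i d]
      by (cases "i = Suc d") (auto simp: P_def)
  qed simp
  then have "?S \<noteq> UNIV" using F_step(4)[of d] by auto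
  moreover have "?S = {0} \<or> ?S = UNIV"
  proof (rule invariant_set_sum_trivial)
    fix i v assume i: "i \<in> {..Suc d}" and v: "v \<in> P i"
    show "X v \<in> ?S \<and> Y v \<in> ?S"
    proof
      show "X v \<in> ?S"
      proof (cases i)
        case 0
        then show ?thesis using v P_ends subspace_0[OF S] lin_simps(4)[OF X] by simp
      next
        case (Suc k)
        then have k: "k \<le> d" "Suc d - Suc k = d - k" "Suc d - k = Suc (d - k)" using i by auto
        have "X v - \<mu> k *s v \<in> F k" "X v \<in> G (Suc (d - k))" "v \<in> G (Suc (d - k))"
          using v Suc k F_step(1)[of k v] G_step(2)[of "d - k" v] G_step(3)[of "d - k"]
          by (auto simp: P_def)
        then have "X v - \<mu> k *s v \<in> P k"
          using k subspace_diff[OF subspace_G] subspace_scale[OF subspace_G] by (auto simp: P_def)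
        then show ?thesis
          using i v Suc PS[of k] PS[of i] subspace_diff_scaled[OF S, of "X v" "\<mu> k" v] by auto
      qed
      show "Y v \<in> ?S"
      proof (cases "i = Suc d")
        case True
        then show ?thesis using v P_ends subspace_0[OF S] lin_simps(4)[OF Y] by simp
      next
        case False
        then have k: "i \<le> d" "Suc d - i = Suc (d - i)" "Suc d - Suc i = d - i" using i by auto
        have "Y v - \<eta> (d - i) *s v \<in> G (d - i)" "Y v \<in> F (Suc i)" "v \<in> F (Suc i)"
          using v k G_step(1)[of "d - i" v] F_step(2)[of i v] F_step(3)[of i]
          by (auto simp: P_def)
        then have "Y v - \<eta> (d - i) *s v \<in> P (Suc i)"
          using k subspace_diff[OF subspace_F] subspace_scale[OF subspace_F] by (auto simp: P_def)
        then show ?thesis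
          using i v k PS[of "Suc i"] PS[of i] subspace_diff_scaled[OF S, of "Y v" "\<eta> (d - i)" v] by auto
      qed
    qed
  qed (simp_all add: P)
  ultimately show ?thesis using PS[OF assms] subspace_0[OF P[of i]] by (auto simp: P_def)
qed

lemma U_lowering:
  assumes "i \<le> d" "v \<in> U i"
  shows "X v - \<mu> i *s v \<in> (if i = 0 then {0} else U (i - 1))"
proof (cases i)
  case 0
  then show ?thesis using assms F_step(1)[of 0 v] F_G_ends by (auto simp: U_def)
next
  case (Suc k)
  then have k: "Suc d - i = Suc d - Suc k" "Suc d - k = Suc (Suc d - i)" "Suc d - i \<le> d" using assms(1) by auto
  have "X v - \<mu> i *s v \<in> F i" "X v \<in> G (Suc d - k)" "v \<in> G (Suc d - k)"
    using assms k F_step(1)[of i v] G_step(2)[of "Suc d - i" v] G_step(3)[of "Suc d - i"] by (auto simp: U_def)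
  then show ?thesis using Suc subspace_diff[OF subspace_G] subspace_scale[OF subspace_G] by (auto simp: U_def)
qed

lemma U_raising:
  assumes "i \<le> d" "v \<in> U i"
  shows "Y v - \<eta> (d - i) *s v \<in> (if i = d then {0} else U (Suc i))"
proof -
  have k: "Suc d - i = Suc (d - i)" "Suc d - Suc i = d - i" using assms(1) by auto
  have 1: "Y v - \<eta> (d - i) *s v \<in> G (d - i)"
    using assms G_step(1)[of "d - i" v] by (simp add: U_def k)
  show ?thesis
  proof (cases "i = d")
    case True
    then show ?thesis using 1 F_G_ends by auto
  next
    case False
    then have "Suc i \<le> d" using assms(1) by simp
    then have "Y v \<in> F (Suc (Suc i))" "v \<in> F (Suc (Suc i))"
      using assms F_step(2)[of "Suc i" v] F_step(3)[of "Suc i"] by (auto simp: U_def)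
    then show ?thesis using False 1 subspace_diff[OF subspace_F] subspace_scale[OF subspace_F]
      by (auto simp: U_def k)
  qed
qed

text \<open>A partial sum is invariant when the next summand is zero, since \<open>Y\<close> then cannot leave it.
  The case \<open>i = d\<close> shows that the \<open>U i\<close> span, and the other cases that none of them is zero.\<close>

lemma U_sum_trivial:
  assumes "i \<le> d" "i = d \<or> U (Suc i) = {0}"
  shows "(\<Sum>k\<le>i. U k) = {0} \<or> (\<Sum>k\<le>i. U k) = UNIV"
proof (rule invariant_set_sum_trivial)
  let ?S = "\<Sum>k\<le>i. U k"
  have S: "subspace ?S" by (rule subspace_set_sum) (simp_all add: subspace_U)
  have US: "U k \<subseteq> ?S" if "k \<le> i" for k using that by (intro subset_set_sum) (auto simp: subspace_U)
  fix k v assume k: "k \<in> {..i}" and v: "v \<in> U k"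
  have ki: "k \<le> i" "k \<le> d" using k assms(1) by auto
  have "X v - \<mu> k *s v \<in> ?S"
  proof (cases "k = 0")
    case True
    then show ?thesis using U_lowering[OF ki(2) v] subspace_0[OF S] by simp
  next
    case False
    then have "X v - \<mu> k *s v \<in> U (k - 1)" using U_lowering[OF ki(2) v] by simp
    moreover have "k - 1 \<le> i" using ki by simp
    ultimately show ?thesis using US by blast
  qed
  moreover have "Y v - \<eta> (d - k) *s v \<in> ?S"
  proof (cases "k = i")
    case True
    then have "Y v - \<eta> (d - k) *s v \<in> {0}" using U_raising[OF ki(2) v] assms(2) by (auto split: if_splits)
    then show ?thesis using subspace_0[OF S] by simp
  next
    case False
    then have "Y v - \<eta> (d - k) *s v \<in> U (Suc k)" "Suc k \<le> i"
      using U_raising[OF ki(2) v] ki assms(1) by auto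
    then show ?thesis using US[of "Suc k"] by auto
  qed
  moreover have "v \<in> ?S" using US[OF ki(1)] v by (rule subsetD)
  ultimately show "X v \<in> ?S \<and> Y v \<in> ?S"
    using subspace_diff_scaled[OF S, of "X v" "\<mu> k" v] subspace_diff_scaled[OF S, of "Y v" "\<eta> (d - k)" v] by simp
qed (simp_all add: subspace_U)

lemma U_0: "U 0 = F 1" by (simp add: U_def F_G_ends)

lemma U_0_subset: "F 1 \<subseteq> (\<Sum>k\<le>i. U k)"
  unfolding U_0[symmetric] by (rule subset_set_sum) (simp_all add: subspace_U)

lemma U_nonzero:
  assumes "i \<le> d"
  shows "U i \<noteq> {0}"
proof
  assume U: "U i = {0}"
  then obtain k where k: "i = Suc k" using U_0 F_G_ends(5) by (cases i) auto
  have "(\<Sum>j\<le>k. U j) \<subseteq> F i"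
  proof (rule set_sum_subset[OF _ subspace_F])
    show "U j \<subseteq> F i" if "j \<in> {..k}" for j
      using that eigenflag_mono[OF F, of "Suc j" i] assms k by (auto simp: U_def)
  qed simp
  then have "(\<Sum>j\<le>k. U j) \<noteq> UNIV" using F_step(4)[OF assms] by auto
  then show False
    using U_sum_trivial[of k] U k assms U_0_subset[of k] F_G_ends(5) subspace_0[OF subspace_F[of 1]] by auto
qed

lemma U_sum: "(\<Sum>i\<le>d. U i) = UNIV"
  using U_sum_trivial[of d] U_0_subset[of d] F_G_ends(5) subspace_0[OF subspace_F[of 1]] by auto

lemma U_coordinates: obtains u where "\<And>i. i \<le> d \<Longrightarrow> u i \<in> U i" "v = (\<Sum>i\<le>d. u i)"
proof -
  have "v \<in> (\<Sum>i\<le>d. U i)" by (simp add: U_sum)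
  then show ?thesis unfolding set_sum_alt[OF finite_atMost] using that by auto
qed

lemma sum_U_in_F: "(\<Sum>i<n. u i) \<in> F n" if "n \<le> Suc d" "\<And>i. i < n \<Longrightarrow> u i \<in> U i"
proof (rule subspace_sum[OF subspace_F])
  fix i assume i: "i \<in> {..<n}"
  then have "u i \<in> F (Suc i)" using that(2)[of i] by (simp add: U_def)
  then show "u i \<in> F n" using i that(1) eigenflag_mono[OF F, of "Suc i" n] by auto
qed

text \<open>The tail lies in \<open>F n\<close>, as the difference of the vector and its head, and in the
  complementary member of \<open>G\<close>. For the zero vector this gives independence of the \<open>U i\<close>; in
  general it shows that \<open>F n\<close> is the sum of the first \<open>n\<close> of them.\<close>

lemma tail_zero_of_mem_F:
  assumes n: "n \<le> Suc d" and u: "\<And>i. i \<le> d \<Longrightarrow> u i \<in> U i" and "(\<Sum>i\<le>d. u i) \<in> F n"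
  shows "(\<Sum>i\<in>{n..d}. u i) = 0"
proof -
  have split: "(\<Sum>i\<le>d. u i) = (\<Sum>i<n. u i) + (\<Sum>i\<in>{n..d}. u i)"
  proof -
    have "{..d} = {..<n} \<union> {n..d}" using n by auto
    moreover have "{..<n} \<inter> {n..d} = {}" by auto
    ultimately show ?thesis by (simp add: sum.union_disjoint)
  qed
  have "(\<Sum>i<n. u i) \<in> F n" using n u by (intro sum_U_in_F) auto
  then have "(\<Sum>i\<in>{n..d}. u i) \<in> F n"
    using assms(3) subspace_diff[OF subspace_F] unfolding split by fastforce
  moreover have "(\<Sum>i\<in>{n..d}. u i) \<in> G (Suc d - n)"
  proof (rule subspace_sum[OF subspace_G])
    fix i assume "i \<in> {n..d}"
    then show "u i \<in> G (Suc d - n)"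
      using u[of i] subsetD[OF eigenflag_mono[OF G, of "Suc d - i" "Suc d - n"]] by (auto simp: U_def)
  qed
  ultimately have "(\<Sum>i\<in>{n..d}. u i) \<in> F n \<inter> G (Suc d - n)" by (rule IntI)
  then show ?thesis unfolding F_Int_G[OF n] by simp
qed

lemma decomposition_U: "decomposition scale d U"
proof -
  have "u i = 0" if u: "\<forall>i\<le>d. u i \<in> U i" "(\<Sum>i\<le>d. u i) = 0" and i: "i \<le> d" for u i
  proof -
    have z: "(\<Sum>i\<in>{n..d}. u i) = 0" if "n \<le> Suc d" for n
      using u that subspace_0[OF subspace_F] by (intro tail_zero_of_mem_F) auto
    have "(\<Sum>k\<in>{i..d}. u k) = u i + (\<Sum>k\<in>{Suc i..d}. u k)"
      using i by (rule sum.atLeast_Suc_atMost)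
    then show ?thesis using z[of i] z[of "Suc i"] i by simp
  qed
  then show ?thesis unfolding decomposition_def by (simp add: subspace_U U_nonzero U_sum)
qed

lemma eq_if_eq_on_U:
  assumes "lin f" "lin g" "\<And>i v. i \<le> d \<Longrightarrow> v \<in> U i \<Longrightarrow> f v = g v"
  shows "f v = g v"
proof -
  have "subspace {v. f v - g v \<in> {0}}"
    by (rule subspace_vimage[OF lin_diff[OF assms(1,2)] subspace_single_0])
  then have "(\<Sum>i\<le>d. U i) \<subseteq> {v. f v - g v \<in> {0}}"
    by (intro set_sum_subset) (auto simp: assms(3))
  then have "v \<in> {v. f v - g v \<in> {0}}" unfolding U_sum by blast
  then show ?thesis by simp
qed

lemma triangular_on_F:
  assumes "lin T" and T: "\<And>i v. i \<le> d \<Longrightarrow> v \<in> U i \<Longrightarrow> T v = \<tau> i *s v"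
    and n: "n \<le> d" and v: "v \<in> F (Suc n)"
  shows "T v - \<tau> n *s v \<in> F n"
proof -
  obtain u where u: "\<And>i. i \<le> d \<Longrightarrow> u i \<in> U i" "v = (\<Sum>i\<le>d. u i)" using U_coordinates by blast
  have "(\<Sum>i\<in>{Suc n..d}. u i) = 0" using n u v by (intro tail_zero_of_mem_F) auto
  moreover have "{..d} = {..n} \<union> {Suc n..d}" using n by auto
  ultimately have "v = (\<Sum>i\<le>n. u i)"
    using u(2) by (simp add: sum.union_disjoint)
  then have v: "v = (\<Sum>i<n. u i) + u n" by (simp add: lessThan_Suc_atMost[symmetric])
  interpret T: Vector_Spaces.linear scale scale T by (rule assms(1))
  have "T (\<Sum>i<n. u i) = (\<Sum>i<n. T (u i))" by (rule T.sum)
  also have "\<dots> = (\<Sum>i<n. \<tau> i *s u i)" using u n T by (intro sum.cong) auto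
  finally have "T v - \<tau> n *s v = (\<Sum>i<n. \<tau> i *s u i) - \<tau> n *s (\<Sum>i<n. u i)"
    using T[OF n u(1)[OF n]] by (simp add: v lin_simps[OF assms(1)] scale_right_distrib)
  also have "\<dots> \<in> F n"
    using u n by (intro subspace_diff[OF subspace_F] subspace_scale[OF subspace_F] sum_U_in_F subspace_scale[OF subspace_U]) auto
  finally show ?thesis .
qed

lemma triangular_on_G:
  assumes "lin T" and T: "\<And>i v. i \<le> d \<Longrightarrow> v \<in> U i \<Longrightarrow> T v = \<tau> i *s v"
    and n: "n \<le> d" and v: "v \<in> G (Suc n)"
  shows "T v - \<tau> (d - n) *s v \<in> G n"
proof -
  interpret sw: split_decomposition scale d Y X \<eta> \<mu> G F by (rule swap)
  have "sw.U i = U (d - i)" if "i \<le> d" for i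
    using that by (auto simp: U_def sw.U_def Suc_diff_le)
  then show ?thesis using assms by (intro sw.triangular_on_F[of T "\<lambda>i. \<tau> (d - i)"]) auto
qed

end

section \<open>Relations and the first triple\<close>

definition weight :: "'f::field \<Rightarrow> nat \<Rightarrow> nat \<Rightarrow> 'f" where
  "weight q d i = q powi (int d - 2 * int i)"

lemma weight_nonzero: "q \<noteq> 0 \<Longrightarrow> weight q d i \<noteq> 0"
  by (simp add: weight_def)

lemma weight_Suc: "q \<noteq> 0 \<Longrightarrow> q\<^sup>2 * weight q d (Suc i) = weight q d i"
  unfolding weight_def by (simp add: power_int_diff power_int_add power_int_minus field_simps power2_eq_square)

context split_decomposition begin

text \<open>The part of \<open>Y\<close> that raises \<open>U i\<close> multiplies the eigenvalue of \<open>K\<close> by \<open>q\<^sup>-\<^sup>2\<close>, so it drops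
  out of \<open>q\<^sup>2KY - YK\<close>; the diagonal part contributes \<open>(q\<^sup>2 - 1)\<close> times \<open>\<eta> (d - i)\<close> times the
  weight.\<close>

lemma weight_map_raising:
  assumes K: "lin K" "\<And>i v. i \<le> d \<Longrightarrow> v \<in> U i \<Longrightarrow> K v = weight q d i *s v"
    and q: "q \<noteq> 0" and a: "a \<noteq> 0"
    and \<eta>: "\<And>i. i \<le> d \<Longrightarrow> \<eta> (d - i) = a * weight q d i + inverse (a * weight q d i)"
  shows "q\<^sup>2 *s K (a *s Y v) = a *s Y (K v) + (q\<^sup>2 - 1) *s (a\<^sup>2 *s K (K v) + 1 *s v)"
proof (rule eq_if_eq_on_U[where f = "\<lambda>v. q\<^sup>2 *s K (a *s Y v)"
      and g = "\<lambda>v. a *s Y (K v) + (q\<^sup>2 - 1) *s (a\<^sup>2 *s K (K v) + 1 *s v)"])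
  show "lin (\<lambda>v. q\<^sup>2 *s K (a *s Y v))" "lin (\<lambda>v. a *s Y (K v) + (q\<^sup>2 - 1) *s (a\<^sup>2 *s K (K v) + 1 *s v))"
    by (intro lin_plus lin_scaled lin_ident lin_comp[OF K(1) lin_scaled[OF Y]] lin_comp[OF Y K(1)]
        lin_comp[OF K(1) K(1)])+
  fix i v assume i: "i \<le> d" and v: "v \<in> U i"
  let ?t = "weight q d i"
  define w where "w = Y v - \<eta> (d - i) *s v"
  have w: "q\<^sup>2 *s K w = ?t *s w"
  proof (cases "i = d")
    case True
    then have "w = 0" using U_raising[OF i v] by (simp add: w_def)
    then show ?thesis by (simp add: lin_simps[OF K(1)])
  next
    case False
    then have "w \<in> U (Suc i)" using U_raising[OF i v] by (simp add: w_def)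
    then have "K w = weight q d (Suc i) *s w" using False i by (intro K(2)) auto
    then show ?thesis by (simp add: weight_Suc[OF q])
  qed
  have Yv: "Y v = w + \<eta> (d - i) *s v" by (simp add: w_def)
  have coeff: "a * (\<eta> (d - i) * ?t) = a\<^sup>2 * (?t * ?t) + 1"
    using weight_nonzero[OF q, of d i] a by (simp add: \<eta>[OF i] field_simps power2_eq_square)
  have KK: "a\<^sup>2 *s K (K v) + 1 *s v = (a * (\<eta> (d - i) * ?t)) *s v"
    unfolding coeff by (simp add: K(2)[OF i v] lin_simps[OF K(1)] scale_left_distrib)
  have "q\<^sup>2 *s K (a *s Y v) = a *s (q\<^sup>2 *s K w) + (q\<^sup>2 * (a * (\<eta> (d - i) * ?t))) *s v"
    by (simp add: Yv lin_simps[OF K(1)] K(2)[OF i v] scale_right_distrib mult_ac)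
  moreover have "a *s Y (K v) = a *s ?t *s w + (a * (\<eta> (d - i) * ?t)) *s v"
    by (simp add: Yv lin_simps[OF Y] K(2)[OF i v] scale_right_distrib mult_ac)
  ultimately show "q\<^sup>2 *s K (a *s Y v) = a *s Y (K v) + (q\<^sup>2 - 1) *s (a\<^sup>2 *s K (K v) + 1 *s v)"
    unfolding w KK by (simp add: algebra_simps)
qed

text \<open>The part of \<open>X\<close> that lowers \<open>U i\<close> multiplies the eigenvalue of \<open>K\<close> by \<open>q\<^sup>2\<close>, so it drops out
  with the factors in the opposite order.\<close>

lemma weight_map_lowering:
  assumes K: "lin K" "\<And>i v. i \<le> d \<Longrightarrow> v \<in> U i \<Longrightarrow> K v = weight q d i *s v"
    and q: "q \<noteq> 0" and b: "b \<noteq> 0"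
    and \<mu>: "\<And>i. i \<le> d \<Longrightarrow> \<mu> i = b * weight q d i + inverse (b * weight q d i)"
  shows "q\<^sup>2 *s b *s X (K v) = K (b *s X v) + (q\<^sup>2 - 1) *s (b\<^sup>2 *s K (K v) + 1 *s v)"
proof (rule eq_if_eq_on_U[where f = "\<lambda>v. q\<^sup>2 *s b *s X (K v)"
      and g = "\<lambda>v. K (b *s X v) + (q\<^sup>2 - 1) *s (b\<^sup>2 *s K (K v) + 1 *s v)"])
  show "lin (\<lambda>v. q\<^sup>2 *s b *s X (K v))" "lin (\<lambda>v. K (b *s X v) + (q\<^sup>2 - 1) *s (b\<^sup>2 *s K (K v) + 1 *s v))"
    by (intro lin_plus lin_scaled lin_ident lin_comp[OF K(1) lin_scaled[OF X]] lin_comp[OF X K(1)]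
        lin_comp[OF K(1) K(1)])+
  fix i v assume i: "i \<le> d" and v: "v \<in> U i"
  let ?t = "weight q d i"
  define w where "w = X v - \<mu> i *s v"
  have w: "K w = (q\<^sup>2 * ?t) *s w"
  proof (cases i)
    case 0
    then have "w = 0" using U_lowering[OF i v] by (simp add: w_def)
    then show ?thesis by (simp add: lin_simps[OF K(1)])
  next
    case (Suc k)
    then have "w \<in> U k" using U_lowering[OF i v] by (simp add: w_def)
    then have "K w = weight q d k *s w" using Suc i by (intro K(2)) auto
    then show ?thesis by (simp add: Suc weight_Suc[OF q])
  qed
  have Xv: "X v = w + \<mu> i *s v" by (simp add: w_def)
  have coeff: "b * (\<mu> i * ?t) = b\<^sup>2 * (?t * ?t) + 1"
    using weight_nonzero[OF q, of d i] b by (simp add: \<mu>[OF i] field_simps power2_eq_square)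
  have KK: "b\<^sup>2 *s K (K v) + 1 *s v = (b * (\<mu> i * ?t)) *s v"
    unfolding coeff by (simp add: K(2)[OF i v] lin_simps[OF K(1)] scale_left_distrib)
  have "q\<^sup>2 *s b *s X (K v) = b *s K w + (q\<^sup>2 * (b * (\<mu> i * ?t))) *s v"
    unfolding w by (simp add: Xv lin_simps[OF X] K(2)[OF i v] scale_right_distrib mult_ac)
  moreover have "K (b *s X v) = b *s K w + (b * (\<mu> i * ?t)) *s v"
    by (simp add: Xv lin_simps[OF K(1)] K(2)[OF i v] scale_right_distrib mult_ac)
  ultimately show "q\<^sup>2 *s b *s X (K v) = K (b *s X v) + (q\<^sup>2 - 1) *s (b\<^sup>2 *s K (K v) + 1 *s v)"
    unfolding KK by (simp add: algebra_simps)
qed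

end

context linear_algebra begin

text \<open>The first of the eight triples for arbitrary flags with the given diagonals, so that it can
  be specialised to the other seven. The two decompositions share the flag \<open>F\<close>, on which \<open>K\<close>, \<open>B\<close>
  and hence \<open>M\<close> have the same diagonal.\<close>

lemma equitable_triple_of_splits:
  assumes KS: "split_decomposition scale d X Y \<mu> \<eta> F G" and BS: "split_decomposition scale d X Y \<mu> \<eta>' F H"
    and q: "q \<noteq> 0" "q\<^sup>2 \<noteq> 1" and a: "a \<noteq> 0" "a\<^sup>2 \<noteq> 1" and b: "b \<noteq> 0"
    and \<mu>: "\<And>i. i \<le> d \<Longrightarrow> \<mu> i = b * weight q d i + inverse (b * weight q d i)"
    and \<eta>: "\<And>i. i \<le> d \<Longrightarrow> \<eta> (d - i) = a * weight q d i + inverse (a * weight q d i)"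
    and \<eta>': "\<And>i. i \<le> d \<Longrightarrow> \<eta>' (d - i) = inverse a * weight q d i + inverse (inverse a * weight q d i)"
    and K: "lin K" "\<And>i v. i \<le> d \<Longrightarrow> v \<in> F (Suc i) \<inter> G (Suc d - i) \<Longrightarrow> K v = weight q d i *s v"
    and B: "lin B" "\<And>i v. i \<le> d \<Longrightarrow> v \<in> F (Suc i) \<inter> H (Suc d - i) \<Longrightarrow> B v = weight q d i *s v"
  shows "equitable_triple scale q (\<lambda>v. a *s Y v - a\<^sup>2 *s K v)
    (inv\<^bsub>End_ring scale\<^esub> (\<lambda>v. (1 / (a - inverse a)) *s (a *s K v - inverse a *s B v))) K"
proof -
  interpret KS: split_decomposition scale d X Y \<mu> \<eta> F G by (rule KS)
  interpret BS: split_decomposition scale d X Y \<mu> \<eta>' F H by (rule BS)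
  note KU = K(2)[folded KS.U_def] and BU = B(2)[folded BS.U_def]
  note t_nz = weight_nonzero[OF q(1), of d]
  define A where "A v = a *s Y v" for v
  define As where "As v = b *s X v" for v
  define R where "R v = A v - a\<^sup>2 *s K v" for v
  define M where "M v = (1 / (a\<^sup>2 - 1)) *s (a\<^sup>2 *s K v - B v)" for v
  have lin: "lin A" "lin As" "lin R" "lin M"
    unfolding A_def[abs_def] As_def[abs_def] R_def[abs_def] M_def[abs_def]
    by (intro lin_diff lin_scaled KS.X KS.Y K(1) B(1))+
  have KA: "q\<^sup>2 *s K (A v) = A (K v) + (q\<^sup>2 - 1) *s (a\<^sup>2 *s K (K v) + 1 *s v)" for v
    unfolding A_def by (rule KS.weight_map_raising[OF K(1) KU q(1) a(1) \<eta>])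
  have KAs: "q\<^sup>2 *s As (K v) = K (As v) + (q\<^sup>2 - 1) *s (b\<^sup>2 *s K (K v) + 1 *s v)" for v
    unfolding As_def by (rule KS.weight_map_lowering[OF K(1) KU q(1) b \<mu>])
  have BAs: "q\<^sup>2 *s As (B v) = B (As v) + (q\<^sup>2 - 1) *s (b\<^sup>2 *s B (B v) + 1 *s v)" for v
    unfolding As_def by (rule BS.weight_map_lowering[OF B(1) BU q(1) b \<mu>])
  have BA: "q\<^sup>2 *s B (A v) = A (B v) + (q\<^sup>2 - 1) *s (1 *s B (B v) + a\<^sup>2 *s v)" for v
  proof -
    have A': "A w = a\<^sup>2 *s inverse a *s Y w" for w
      using a(1) by (simp add: A_def power2_eq_square)
    have a2: "a\<^sup>2 * (inverse a)\<^sup>2 = 1" using a(1) by (simp flip: power_mult_distrib)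
    have "q\<^sup>2 *s B (A v) = a\<^sup>2 *s (q\<^sup>2 *s B (inverse a *s Y v))"
      unfolding A' by (simp only: lin_simps[OF B(1)] scale_left_commute)
    also have "q\<^sup>2 *s B (inverse a *s Y v) = inverse a *s Y (B v) + (q\<^sup>2 - 1) *s ((inverse a)\<^sup>2 *s B (B v) + 1 *s v)"
      by (rule BS.weight_map_raising[OF B(1) BU q(1) _ \<eta>']) (use a in simp_all)
    also have "a\<^sup>2 *s \<dots> = A (B v) + (q\<^sup>2 - 1) *s ((a\<^sup>2 * (inverse a)\<^sup>2) *s B (B v) + a\<^sup>2 *s v)"
      unfolding A' by (simp only: scale_right_distrib scale_scale mult_ac mult_1_left mult_1_right)
    finally show ?thesis unfolding a2 .
  qed
  have irr: "W = {0} \<or> W = UNIV" if "subspace W" "A ` W \<subseteq> W" "As ` W \<subseteq> W" for W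
  proof (rule KS.irreducible[OF that(1)])
    show "X ` W \<subseteq> W"
    proof (rule image_subsetI)
      fix v assume "v \<in> W"
      then have "inverse b *s As v \<in> W" using that by (intro subspace_scale) auto
      then show "X v \<in> W" using b by (simp add: As_def)
    qed
    show "Y ` W \<subseteq> W"
    proof (rule image_subsetI)
      fix v assume "v \<in> W"
      then have "inverse a *s A v \<in> W" using that by (intro subspace_scale) auto
      then show "Y v \<in> W" using a by (simp add: A_def)
    qed
  qed
  have F1: "K v = weight q d 0 *s v" "B v = weight q d 0 *s v" if "v \<in> F 1" for v
    using KU[of 0 v] BU[of 0 v] that by (simp_all add: KS.U_0 BS.U_0)
  have KB_quadratic: "KB_quadratic (q\<^sup>2) (a\<^sup>2) K B v = 0" for v
    by (rule quadratic_vanishes[OF lin(1,2) K(1) B(1) a(2) _ KA BA KAs BAs irr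
          KS.subspace_F KS.F_G_ends(5) F1]) (use q in simp)
  note rel = relations_of_quadratic[OF lin(1) K(1) B(1) KB_quadratic a(2) KA BA, folded R_def M_def]
  have K_F: "K v - weight q d n *s v \<in> F n" if "n \<le> d" "v \<in> F (Suc n)" for n v
    using KS.triangular_on_F[of K "weight q d" n v] K(1) KU that by blast
  have K_G: "K v - weight q d (d - n) *s v \<in> G n" if "n \<le> d" "v \<in> G (Suc n)" for n v
    using KS.triangular_on_G[of K "weight q d" n v] K(1) KU that by blast
  have B_F: "B v - weight q d n *s v \<in> F n" if "n \<le> d" "v \<in> F (Suc n)" for n v
    using BS.triangular_on_F[of B "weight q d" n v] B(1) BU that by blast
  have bij_K: "bij K"
    by (rule triangular_bij[of K F d "weight q d", OF K(1) KS.subspace_F KS.F_G_ends(1,2) K_F t_nz])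
  have bij_M: "bij M"
  proof (rule triangular_bij[of M F d "weight q d"])
    fix n v assume n: "n \<le> d" and v: "v \<in> F (Suc n)"
    have "M v - weight q d n *s v = (1 / (a\<^sup>2 - 1)) *s (a\<^sup>2 *s (K v - weight q d n *s v) - (B v - weight q d n *s v))"
    proof -
      have "weight q d n *s v = (1 / (a\<^sup>2 - 1)) *s ((a\<^sup>2 - 1) *s weight q d n *s v)" using a by simp
      then show ?thesis unfolding M_def by (simp only: scale_expand scale_one) (simp add: algebra_simps)
    qed
    also have "\<dots> \<in> F n"
      by (rule subspace_scale[OF KS.subspace_F subspace_diff[OF KS.subspace_F 
            subspace_scale[OF KS.subspace_F K_F[OF n v]] B_F[OF n v]]])
    finally show "M v - weight q d n *s v \<in> F n" .
  qed (use lin KS.subspace_F KS.F_G_ends t_nz in auto)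
  have bij_R: "bij R"
  proof (rule triangular_bij[of R G d "\<lambda>n. inverse (weight q d (d - n))"])
    fix n v assume n: "n \<le> d" and v: "v \<in> G (Suc n)"
    have "a * \<eta> n - a\<^sup>2 * weight q d (d - n) = inverse (weight q d (d - n))"
      using \<eta>[of "d - n"] n a(1) t_nz[of "d - n"] by (simp add: field_simps power2_eq_square)
    then have "R v - inverse (weight q d (d - n)) *s v = a *s (Y v - \<eta> n *s v) - a\<^sup>2 *s (K v - weight q d (d - n) *s v)"
      unfolding R_def A_def by (simp add: scale_expand flip: \<open>_ = inverse _\<close>)
    also have "\<dots> \<in> G n"
      by (rule subspace_diff[OF KS.subspace_G subspace_scale[OF KS.subspace_G KS.G_step(1)[OF n v]]
            subspace_scale[OF KS.subspace_G K_G[OF n v]]])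
    finally show "R v - inverse (weight q d (d - n)) *s v \<in> G n" .
  qed (use lin KS.subspace_G KS.F_G_ends t_nz in auto)
  have "(\<lambda>v. (1 / (a - inverse a)) *s (a *s K v - inverse a *s B v)) = M"
  proof
    fix v
    have "a\<^sup>2 - 1 = a * (a - inverse a)" using a(1) by (simp add: field_simps power2_eq_square)
    moreover have "a\<^sup>2 *s K v - B v = a *s (a *s K v - inverse a *s B v)"
      using a(1) by (simp add: scale_right_diff_distrib power2_eq_square)
    ultimately show "(1 / (a - inverse a)) *s (a *s K v - inverse a *s B v) = M v"
      using a(1) by (simp add: M_def)
  qed
  moreover have "(\<lambda>v. a *s Y v - a\<^sup>2 *s K v) = R" by (simp add: R_def[abs_def] A_def)
  moreover have "equitable_triple scale q R (inv\<^bsub>End_ring scale\<^esub> M) K"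
    by (rule equitable_tripleI[OF q lin(3,4) K(1) bij_R bij_M bij_K rel])
  ultimately show ?thesis by simp
qed

end

section \<open>Eigenspaces of the two generators\<close>

text \<open>The relator of the algebra, evaluated on the component of \<open>Y v\<close> with eigenvalue \<open>x\<close> where
  \<open>v\<close> is an eigenvector of \<open>X\<close> with eigenvalue \<open>y\<close>, is \<open>x - y\<close> times this symmetric polynomial.\<close>

definition onsager_factor :: "'f::field \<Rightarrow> 'f \<Rightarrow> 'f \<Rightarrow> 'f" where
  "onsager_factor q x y = x\<^sup>2 - (q\<^sup>2 + (inverse q)\<^sup>2) * x * y + y\<^sup>2 + (q\<^sup>2 - (inverse q)\<^sup>2)\<^sup>2"

context linear_algebra begin

lemma eigenvectors_independent:
  assumes "lin X" "finite J" "inj_on x J"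
    and "\<And>j. j \<in> J \<Longrightarrow> X (w j) = x j *s w j" "(\<Sum>j\<in>J. w j) = 0" "j \<in> J"
  shows "w j = 0"
  using assms(2-)
proof (induction J arbitrary: w j rule: finite_induct)
  case (insert k J)
  interpret X: Vector_Spaces.linear scale scale X by (rule assms(1))
  have "0 = X (w k + (\<Sum>j\<in>J. w j)) - x k *s (w k + (\<Sum>j\<in>J. w j))"
    using insert by (simp add: X.zero)
  also have "\<dots> = (\<Sum>j\<in>J. x j *s w j) - (\<Sum>j\<in>J. x k *s w j)"
    using insert.prems(2) by (simp add: X.add X.sum scale_right_distrib scale_sum_right)
  also have "\<dots> = (\<Sum>j\<in>J. (x j - x k) *s w j)"
    by (simp add: scale_left_diff_distrib sum_subtractf)
  finally have sum: "(\<Sum>j\<in>J. (x j - x k) *s w j) = 0" by simp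
  have J: "w j = 0" if j: "j \<in> J" for j
  proof -
    have "(x j - x k) *s w j = 0"
    proof (rule insert.IH[OF _ _ sum j])
      show "inj_on x J" using insert.prems(1) by simp
      show "X ((x i - x k) *s w i) = x i *s (x i - x k) *s w i" if "i \<in> J" for i
        using insert.prems(2)[of i] that by (simp add: X.scale mult.commute)
    qed
    moreover have "x j \<noteq> x k" using insert.prems(1) insert.hyps(2) j by (auto simp: inj_on_def)
    ultimately show ?thesis by simp
  qed
  then have "w k = 0" using insert by simp
  then show ?case using J insert.prems(4) by auto
qed simp

lemma subspace_eigenspace: "lin X \<Longrightarrow> subspace (eigenspace scale X c)"
  unfolding subspace_def eigenspace_def by (simp add: lin_simps scale_right_distrib mult.commute)

definition eigen_system :: "nat \<Rightarrow> ('v \<Rightarrow> 'v) \<Rightarrow> (nat \<Rightarrow> 'f) \<Rightarrow> (nat \<Rightarrow> 'v set) \<Rightarrow> bool" where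
  "eigen_system d X \<mu> E \<longleftrightarrow> inj_on \<mu> {..d} \<and> (\<forall>i\<le>d. E i = eigenspace scale X (\<mu> i) \<and> E i \<noteq> {0}) \<and>
     (\<Sum>i\<le>d. E i) = UNIV"

lemma eigen_system_diagonalizable:
  assumes "lin X" "diagonalizable scale X" "inj_on \<mu> {..d}" "\<mu> ` {..d} = eigenvalues scale X"
    and E: "\<And>i. i \<le> d \<Longrightarrow> E i = eigenspace scale X (\<mu> i)"
  shows "eigen_system d X \<mu> E"
proof -
  have E_sub: "subspace (E i)" if "i \<le> d" for i using E[OF that] subspace_eigenspace[OF assms(1)] by simp
  have nonzero: "E i \<noteq> {0}" if "i \<le> d" for i
  proof -
    have "\<mu> i \<in> eigenvalues scale X" using assms(4) that by blast
    then show ?thesis using E[OF that] by (auto simp: eigenvalues_def eigenspace_def)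
  qed
  have "(\<Union>c\<in>eigenvalues scale X. eigenspace scale X c) \<subseteq> (\<Sum>i\<le>d. E i)"
  proof (rule UN_least)
    fix c assume "c \<in> eigenvalues scale X"
    then obtain i where "i \<le> d" "c = \<mu> i" unfolding assms(4)[symmetric] by auto
    then show "eigenspace scale X c \<subseteq> (\<Sum>i\<le>d. E i)"
      using subset_set_sum[of "{..d}" E i] E_sub E by auto
  qed
  then have "span (\<Union>c\<in>eigenvalues scale X. eigenspace scale X c) \<subseteq> (\<Sum>i\<le>d. E i)"
    by (rule span_minimal) (use E_sub in \<open>auto intro: subspace_set_sum\<close>)
  then have "(\<Sum>i\<le>d. E i) = UNIV" using assms(2) unfolding diagonalizable_def by auto
  then show ?thesis unfolding eigen_system_def using assms(3) E nonzero by simp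
qed

lemma eigen_system_reverse:
  assumes "eigen_system d X \<mu> E"
  shows "eigen_system d X (\<lambda>i. \<mu> (d - i)) (\<lambda>i. E (d - i))"
proof -
  have "inj_on (\<lambda>i. \<mu> (d - i)) {..d}"
    using assms unfolding eigen_system_def inj_on_def by (metis atMost_iff diff_diff_cancel diff_le_self)
  moreover have "(\<Sum>i\<le>d. E (d - i)) = (\<Sum>i\<le>d. E i)"
    by (rule sum.reindex_bij_witness[of _ "\<lambda>i. d - i" "\<lambda>i. d - i"]) auto
  moreover have "(\<Sum>i\<le>d. E i) = UNIV" and "E i = eigenspace scale X (\<mu> i)" "E i \<noteq> {0}" if "i \<le> d" for i
    using assms that unfolding eigen_system_def by blast+
  ultimately show ?thesis unfolding eigen_system_def by auto
qed

lemma eigenflag_of_eigen_system: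
  assumes X: "lin X" and Y: "lin Y" and E: "eigen_system d X \<mu> E"
    and tri: "\<And>i v. i \<le> d \<Longrightarrow> v \<in> E i \<Longrightarrow> Y v \<in> (\<Sum>j | j \<le> d \<and> \<bar>int j - int i\<bar> \<le> 1. E j)"
  shows "eigenflag d X \<mu> Y (\<lambda>n. \<Sum>j | j \<le> d \<and> j < n. E j)"
proof -
  let ?F = "\<lambda>n. \<Sum>j | j \<le> d \<and> j < n. E j"
  have E_sub: "subspace (E j)" if "j \<le> d" for j using E that subspace_eigenspace[OF X]
    by (simp add: eigen_system_def)
  have fin: "finite {j. j \<le> d \<and> P j}" for P by (rule finite_subset[of _ "{..d}"]) auto
  have F_sub: "subspace (?F n)" for n using E_sub by (intro subspace_set_sum fin) auto
  have E_F: "E j \<subseteq> ?F n" if "j \<le> d" "j < n" for j n using that E_sub by (intro subset_set_sum fin) auto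
  have mono: "?F m \<subseteq> ?F n" if "m \<le> n" for m n using that E_sub by (intro set_sum_mono fin) auto
  have eig: "X v = \<mu> j *s v" if "j \<le> d" "v \<in> E j" for j v
    using E that by (simp add: eigen_system_def eigenspace_def)
  have nz: "E j \<noteq> {0}" if "j \<le> d" for j using E that unfolding eigen_system_def by blast
  have "{j. j \<le> d \<and> j < Suc d} = {..d}" by auto
  then have F_top: "?F (Suc d) = UNIV" using E unfolding eigen_system_def by (simp only:)
  have lower: "X v - \<mu> n *s v \<in> ?F n" if n: "n \<le> d" and v: "v \<in> ?F (Suc n)" for n v
  proof -
    have lin: "lin (\<lambda>v. X v - \<mu> n *s v)" using X lin_ident by (intro lin_diff lin_scaled)
    have "?F (Suc n) \<subseteq> {v. X v - \<mu> n *s v \<in> ?F n}"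
    proof (rule set_sum_subset[OF fin subspace_vimage[OF lin F_sub]])
      fix j assume j: "j \<in> {j. j \<le> d \<and> j < Suc n}"
      show "E j \<subseteq> {v. X v - \<mu> n *s v \<in> ?F n}"
      proof clarify
        fix v assume v: "v \<in> E j"
        have Xv: "X v - \<mu> n *s v = (\<mu> j - \<mu> n) *s v" using j eig[of j v] v
          by (simp add: scale_left_diff_distrib)
        show "X v - \<mu> n *s v \<in> ?F n"
        proof (cases "j = n")
          case True
          then show ?thesis unfolding Xv using subspace_0[OF F_sub] by simp
        next
          case False
          then have "v \<in> ?F n" using E_F[of j n] j v by auto
          then show ?thesis unfolding Xv by (rule subspace_scale[OF F_sub])
        qed
      qed
    qed
    then show ?thesis using v by auto
  qed
  have raise: "Y v \<in> ?F (Suc n)" if v: "v \<in> ?F n" for n v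
  proof -
    have "?F n \<subseteq> {v. Y v \<in> ?F (Suc n)}"
    proof (rule set_sum_subset[OF fin subspace_vimage[OF Y F_sub]])
      fix j assume j: "j \<in> {j. j \<le> d \<and> j < n}"
      have "(\<Sum>k | k \<le> d \<and> \<bar>int k - int j\<bar> \<le> 1. E k) \<subseteq> ?F (Suc n)"
        using j E_sub by (intro set_sum_mono fin) auto
      then show "E j \<subseteq> {v. Y v \<in> ?F (Suc n)}" using tri[of j] j by blast
    qed
    then show ?thesis using v by auto
  qed
  have proper: "?F n \<noteq> UNIV" if n: "n \<le> d" for n
  proof
    assume F: "?F n = UNIV"
    obtain e where e: "e \<in> E n" "e \<noteq> 0" using nz[OF n] subspace_0[OF E_sub[OF n]] by blast
    have "e \<in> ?F n" by (simp add: F)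
    then obtain w where w: "e = (\<Sum>j | j \<le> d \<and> j < n. w j)" "\<And>j. j \<le> d \<and> j < n \<Longrightarrow> w j \<in> E j"
      unfolding set_sum_alt[OF fin] by auto
    \<comment> \<open>A vector of \<open>E n\<close> in the sum of the earlier eigenspaces would be a linear dependence.\<close>
    define w' where "w' j = (if j = n then - e else w j)" for j
    have "w' n = 0"
    proof (rule eigenvectors_independent[OF X, of "{..n}" \<mu> w'])
      show "inj_on \<mu> {..n}" using E n by (auto simp: eigen_system_def elim!: inj_on_subset)
      show "X (w' j) = \<mu> j *s w' j" if "j \<in> {..n}" for j
        using that w(2)[of j] e n eig[of j] by (auto simp: w'_def lin_simps[OF X])
      have "{j. j \<le> d \<and> j < n} = {..<n}" using n by auto
      then show "(\<Sum>j\<le>n. w' j) = 0"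
        using w(1) by (simp add: w'_def lessThan_Suc_atMost[symmetric])
    qed auto
    then show False using e by (simp add: w'_def)
  qed
  have "{j. j \<le> d \<and> j < 1} = {0}" by auto
  then have "?F 1 \<noteq> {0}" using nz[of 0] by simp
  then show ?thesis unfolding eigenflag_def using F_sub F_top lower raise proper mono[of _ "Suc _"] by simp
qed

lemma eigenflag_of_eigen_system_reverse:
  assumes X: "lin X" and Y: "lin Y" and E: "eigen_system d X \<mu> E"
    and tri: "\<And>i v. i \<le> d \<Longrightarrow> v \<in> E i \<Longrightarrow> Y v \<in> (\<Sum>j | j \<le> d \<and> \<bar>int j - int i\<bar> \<le> 1. E j)"
  shows "eigenflag d X (\<lambda>n. \<mu> (d - n)) Y (\<lambda>n. \<Sum>j | j \<le> d \<and> d < j + n. E j)"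
proof -
  have "Y v \<in> (\<Sum>j | j \<le> d \<and> \<bar>int j - int i\<bar> \<le> 1. E (d - j))" if i: "i \<le> d" and v: "v \<in> E (d - i)" for i v
  proof -
    have "(\<Sum>j | j \<le> d \<and> \<bar>int j - int (d - i)\<bar> \<le> 1. E j) = (\<Sum>j | j \<le> d \<and> \<bar>int j - int i\<bar> \<le> 1. E (d - j))"
      using i by (intro sum.reindex_bij_witness[of _ "\<lambda>j. d - j" "\<lambda>j. d - j"]) auto
    then show ?thesis using tri[OF _ v] by simp
  qed
  note flag = eigenflag_of_eigen_system[OF X Y eigen_system_reverse[OF E] this]
  have "(\<Sum>j | j \<le> d \<and> d < j + n. E j) = (\<Sum>j | j \<le> d \<and> j < n. E (d - j))" for n
    by (rule sum.reindex_bij_witness[of _ "\<lambda>j. d - j" "\<lambda>j. d - j"]) auto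
  then show ?thesis using flag by simp
qed

definition commutator :: "('v \<Rightarrow> 'v) \<Rightarrow> ('v \<Rightarrow> 'v) \<Rightarrow> 'v \<Rightarrow> 'v" where
  "commutator X Y v = X (Y v) - Y (X v)"

definition q_commutator :: "'f \<Rightarrow> ('v \<Rightarrow> 'v) \<Rightarrow> ('v \<Rightarrow> 'v) \<Rightarrow> 'v \<Rightarrow> 'v" where
  "q_commutator r X Y v = r *s X (Y v) - inverse r *s Y (X v)"

definition onsager_relation :: "'f \<Rightarrow> ('v \<Rightarrow> 'v) \<Rightarrow> ('v \<Rightarrow> 'v) \<Rightarrow> bool" where
  "onsager_relation q X Y \<longleftrightarrow>
     (\<forall>v. commutator X (q_commutator (inverse q) X (q_commutator q X Y)) v
        = ((q\<^sup>2 - (inverse q)\<^sup>2)\<^sup>2) *s commutator Y X v)"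

lemma lin_q_commutator: "lin X \<Longrightarrow> lin Y \<Longrightarrow> lin (q_commutator r X Y)"
  unfolding q_commutator_def[abs_def] by (rule lin_diff[OF lin_scaled[OF lin_comp] lin_scaled[OF lin_comp]])

text \<open>On such a component, \<open>f\<close> multiplies by the eigenvalue on the left and by \<open>y\<close> on the right,
  so each bracket of the relation becomes a scalar factor; independence of eigenvectors then
  separates the components.\<close>

lemma onsager_relation_components:
  fixes d :: nat
  assumes f: "lin f" and g: "lin g" and q: "q \<noteq> 0" and rel: "onsager_relation q f g"
    and v: "f v = y *s v" and x: "inj_on x {..d}"
    and w: "g v = (\<Sum>i\<le>d. w i)" "\<And>i. i \<le> d \<Longrightarrow> f (w i) = x i *s w i"
    and i: "i \<le> d" "w i \<noteq> 0" "x i \<noteq> y"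
  shows "onsager_factor q (x i) y = 0"
proof -
  interpret f: Vector_Spaces.linear scale scale f by (rule f)
  define S where "S c = (\<Sum>i\<le>d. c i *s w i)" for c
  have fS: "f (S c) = S (\<lambda>i. x i * c i)" for c
    unfolding S_def f.sum using w(2) by (intro sum.cong) (auto simp: f.scale mult.commute)
  have S_diff: "S b - S c = S (\<lambda>i. b i - c i)" for b c
    by (simp add: S_def scale_left_diff_distrib sum_subtractf)
  have S_scale: "r *s S c = S (\<lambda>i. r * c i)" for r c
    by (simp add: S_def scale_sum_right)
  have gv: "g v = S (\<lambda>i. 1)" by (simp add: S_def w(1))
  let ?P = "q_commutator q f g"
  let ?R = "q_commutator (inverse q) f ?P"
  have P: "lin ?P" and R: "lin ?R" using f g by (auto intro: lin_q_commutator)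
  have 1: "?P v = S (\<lambda>i. q * x i - inverse q * y)"
    by (simp add: q_commutator_def v lin_simps[OF g] gv fS S_diff S_scale)
  have 2: "?R v = S (\<lambda>i. (inverse q * x i - q * y) * (q * x i - inverse q * y))"
    unfolding q_commutator_def[of "inverse q"] v lin_simps(5)[OF P] 1
    by (simp add: fS S_diff S_scale algebra_simps)
  have 3: "commutator f ?R v = S (\<lambda>i. (x i - y) * ((inverse q * x i - q * y) * (q * x i - inverse q * y)))"
    unfolding commutator_def v lin_simps(5)[OF R] 2 by (simp add: fS S_diff S_scale left_diff_distrib)
  have 4: "commutator g f v = S (\<lambda>i. y - x i)"
    by (simp add: commutator_def v lin_simps[OF g] gv fS S_diff S_scale)
  have c: "(x i - y) * ((inverse q * x i - q * y) * (q * x i - inverse q * y)) - (q\<^sup>2 - (inverse q)\<^sup>2)\<^sup>2 * (y - x i)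
    = (x i - y) * onsager_factor q (x i) y" for i
    unfolding onsager_factor_def using q by (simp add: field_simps power2_eq_square)
  have "S (\<lambda>i. (x i - y) * ((inverse q * x i - q * y) * (q * x i - inverse q * y)))
      - S (\<lambda>i. (q\<^sup>2 - (inverse q)\<^sup>2)\<^sup>2 * (y - x i)) = 0"
    using rel[unfolded onsager_relation_def, rule_format, of v, unfolded 3 4 S_scale] by (simp only: diff_self)
  then have "S (\<lambda>i. (x i - y) * onsager_factor q (x i) y) = 0" unfolding S_diff c .
  then have "((x i - y) * onsager_factor q (x i) y) *s w i = 0"
    unfolding S_def using w(2) i(1)
    by (intro eigenvectors_independent[OF f _ x, of "\<lambda>i. ((x i - y) * onsager_factor q (x i) y) *s w i"])
      (auto simp: f.scale mult.commute)
  then show ?thesis using i by simp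
qed

end

lemma weight_mult: "q \<noteq> 0 \<Longrightarrow> weight q d i * weight q d k = q powi (2 * (int d - int i - int k))"
  unfolding weight_def by (simp add: power_int_add[symmetric] algebra_simps)

lemma weight_reverse: "i \<le> d \<Longrightarrow> weight q d (d - i) = inverse (weight q d i)"
  unfolding weight_def power_int_minus[symmetric]
    by (intro arg_cong[of _ _ "\<lambda>n. q powi n"]) (simp add: of_nat_diff)

lemma weight_inverse: "weight (inverse q) d i = inverse (weight q d i)"
  unfolding weight_def by (simp add: power_int_inverse)

lemma add_inverse_eq_iff:
  fixes u r :: "'f::field"
  assumes "u \<noteq> 0" "r \<noteq> 0"
  shows "u + inverse u = r + inverse r \<longleftrightarrow> u = r \<or> u * r = 1"
proof -
  have "(u + inverse u - (r + inverse r)) * (u * r) = (u - r) * (u * r - 1)"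
    using assms by (simp add: field_simps)
  moreover have "(u + inverse u = r + inverse r) \<longleftrightarrow> (u + inverse u - (r + inverse r)) * (u * r) = 0"
    using assms by simp
  ultimately show ?thesis by simp
qed

text \<open>In terms of \<open>u\<close> and \<open>s\<close> the polynomial is the product of the differences between \<open>u + u\<^sup>-\<^sup>1\<close>
  and \<open>r + r\<^sup>-\<^sup>1\<close> for \<open>r = q\<^sup>2s\<close> and \<open>r = q\<^sup>-\<^sup>2s\<close>.\<close>

lemma onsager_factor_zero:
  fixes q u s :: "'f::field"
  assumes q: "q \<noteq> 0" and u: "u \<noteq> 0" and s: "s \<noteq> 0"
    and "onsager_factor q (u + inverse u) (s + inverse s) = 0"
  shows "u = q\<^sup>2 * s \<or> s = q\<^sup>2 * u \<or> u * s * q\<^sup>2 = 1 \<or> u * s = q\<^sup>2"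
proof -
  \<comment> \<open>The two values of \<open>r\<close> for which \<open>r + r\<^sup>-\<^sup>1\<close> solves the equation for \<open>x\<close>.\<close>
  define r1 r2 where "r1 = q\<^sup>2 * s" and "r2 = s / q\<^sup>2"
  have r: "r1 \<noteq> 0" "r2 \<noteq> 0" using q s by (simp_all add: r1_def r2_def)
  have "onsager_factor q (u + inverse u) (s + inverse s)
      = (u + inverse u - (r1 + inverse r1)) * (u + inverse u - (r2 + inverse r2))"
    unfolding onsager_factor_def r1_def r2_def using q u s by (simp add: field_simps power2_eq_square)
  with assms(4) have "u + inverse u = r1 + inverse r1 \<or> u + inverse u = r2 + inverse r2" by simp
  then show ?thesis
    using q unfolding add_inverse_eq_iff[OF u r(1)] add_inverse_eq_iff[OF u r(2)]
    by (auto simp: r1_def r2_def field_simps)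
qed

lemma power_int_inject:
  fixes q :: "'f::field"
  assumes "q \<noteq> 0" "\<forall>n>0. q ^ n \<noteq> 1" "q powi m = q powi n"
  shows "m = n"
proof -
  have no: False if "q powi k = 1" "k > 0" for k
    using that assms(2)[rule_format, of "nat k"] by (simp add: power_int_def)
  have "q powi (m - n) = 1" "q powi (n - m) = 1"
    using assms(1,3) by (simp_all add: power_int_diff)
  then show ?thesis using no[of "m - n"] no[of "n - m"] by (cases m n rule: linorder_cases) auto
qed

text \<open>The solutions with \<open>q\<^sup>2\<close> as the ratio of the two weights are exactly the neighbours. The
  others make \<open>a\<^sup>2\<close> a power of \<open>q\<^sup>2\<close>; unless \<open>i\<close> and \<open>k\<close> are adjacent at one end of the range,
  that power also makes two of the \<open>\<theta>\<close> coincide.\<close>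

lemma onsager_factor_adjacent:
  fixes q a :: "'f::field"
  assumes q: "q \<noteq> 0" "\<forall>n>0. q ^ n \<noteq> 1" and a: "a \<noteq> 0"
    and \<theta>: "\<And>i. i \<le> d \<Longrightarrow> \<theta> i = a * weight q d i + inverse (a * weight q d i)" and inj: "inj_on \<theta> {..d}"
    and ik: "i \<le> d" "k \<le> d" "i \<noteq> k" and zero: "onsager_factor q (\<theta> i) (\<theta> k) = 0"
  shows "\<bar>int i - int k\<bar> \<le> 1"
proof (rule ccontr)
  assume far: "\<not> ?thesis"
  note t = weight_nonzero[OF q(1), of d]
  have aa: "a * weight q d i * (a * weight q d k) = a\<^sup>2 * q powi (2 * (int d - int i - int k))" for i k
    unfolding weight_mult[OF q(1), symmetric] by (simp add: power2_eq_square)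
  have no_product: "a\<^sup>2 * q powi (2 * (int d - n)) \<noteq> 1" if n: "1 \<le> n" "n \<le> 2 * int d - 1" for n
  proof
    assume 1: "a\<^sup>2 * q powi (2 * (int d - n)) = 1"
    \<comment> \<open>Every such \<open>n\<close> is a sum of two distinct indices.\<close>
    obtain j l where jl: "j \<le> d" "l \<le> d" "j \<noteq> l" "n = int j + int l"
    proof (cases "n \<le> int d")
      case True
      then show ?thesis using n that[of 0 "nat n"] by auto
    next
      case False
      then show ?thesis using n that[of "nat n - d" d] by auto
    qed
    have "a * weight q d j * (a * weight q d l) = 1"
      unfolding aa using 1 jl(4) by (simp add: algebra_simps)
    then have "\<theta> j = \<theta> l" using a t[of j] t[of l] add_inverse_eq_iff[of "a * weight q d j" "a * weight q d l"]
      by (simp add: \<theta>[OF jl(1)] \<theta>[OF jl(2)] del: inverse_mult_distrib)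
    then show False using inj jl by (auto dest: inj_onD)
  qed
  have weight_step: "weight q d i = q\<^sup>2 * weight q d k \<Longrightarrow> int k = int i + 1" for i k
  proof -
    assume eq: "weight q d i = q\<^sup>2 * weight q d k"
    have "q powi (int d - 2 * int i) = q powi (int d - 2 * int k + 2)"
      using eq q(1) by (simp add: weight_def power_int_add power_int_add_1 mult.commute)
    from power_int_inject[OF q this] show ?thesis by simp
  qed
  have "a * weight q d i = q\<^sup>2 * (a * weight q d k) \<or> a * weight q d k = q\<^sup>2 * (a * weight q d i)
      \<or> a * weight q d i * (a * weight q d k) * q\<^sup>2 = 1 \<or> a * weight q d i * (a * weight q d k) = q\<^sup>2"
    using zero a t ik by (intro onsager_factor_zero q(1)) (simp_all add: \<theta>)
  then consider "weight q d i = q\<^sup>2 * weight q d k" | "weight q d k = q\<^sup>2 * weight q d i"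
    | "a * weight q d i * (a * weight q d k) * q\<^sup>2 = 1" | "a * weight q d i * (a * weight q d k) = q\<^sup>2"
    using a by fastforce
  then show False
  proof cases
    case 1
    then show ?thesis using weight_step far by fastforce
  next
    case 2
    then show ?thesis using weight_step far by fastforce
  next
    case 3
    have "q powi (2 * (int d - (int i + int k - 1))) = q powi (2 * (int d - int i - int k)) * q\<^sup>2"
      using q(1) by (subst power_int_add[of q _ 2, simplified, symmetric]) (auto simp: algebra_simps)
    then have "a\<^sup>2 * q powi (2 * (int d - (int i + int k - 1))) = 1" using 3 unfolding aa
      by (simp add: mult.assoc)
    moreover have "1 \<le> int i + int k - 1" "int i + int k - 1 \<le> 2 * int d - 1" using far ik by arith+
    ultimately show ?thesis using no_product by blast
  next
    case 4
    have "q powi (2 * (int d - int i - int k)) = q powi (2 * (int d - (int i + int k + 1))) * q\<^sup>2"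
      using q(1) by (subst power_int_add[of q _ 2, simplified, symmetric]) (auto simp: algebra_simps)
    then have "a\<^sup>2 * q powi (2 * (int d - (int i + int k + 1))) = 1" using 4 q(1) unfolding aa by simp
    moreover have "1 \<le> int i + int k + 1" "int i + int k + 1 \<le> 2 * int d - 1" using far ik by arith+
    ultimately show ?thesis using no_product by blast
  qed
qed

text \<open>Subtracting the equations of two consecutive pairs gives the recursion \<open>x\<^sub>i\<^sub>+\<^sub>2 + x\<^sub>i = (q\<^sup>2
  + q\<^sup>-\<^sup>2) x\<^sub>i\<^sub>+\<^sub>1\<close>, whose solutions are \<open>b t\<^sub>i + c t\<^sub>i\<^sup>-\<^sup>1\<close>; the equation of the first pair then
  says \<open>bc = 1\<close>.\<close>

lemma onsager_sequence:
  fixes q :: "'f::field"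
  assumes q: "q \<noteq> 0" "q ^ 4 \<noteq> 1" and d: "1 \<le> d" and inj: "inj_on x {..d}"
    and zero: "\<And>i. i < d \<Longrightarrow> onsager_factor q (x (Suc i)) (x i) = 0"
  obtains b where "b \<noteq> 0" "\<And>i. i \<le> d \<Longrightarrow> x i = b * weight q d i + inverse (b * weight q d i)"
proof -
  define t where "t = weight q d"
  have t: "t i \<noteq> 0" and t_Suc: "t (Suc i) = t i / q\<^sup>2" for i
    using weight_nonzero[OF q(1)] weight_Suc[OF q(1), of d i] q(1) by (auto simp: t_def field_simps)
  define e where "e = q\<^sup>2 - (inverse q)\<^sup>2"
  have e: "e \<noteq> 0"
  proof
    assume "e = 0"
    then have "q\<^sup>2 * q\<^sup>2 = 1" using q(1) by (simp add: e_def power_inverse field_simps)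
    then show False using q(2) by (simp add: power4_eq_xxxx power2_eq_square mult.assoc)
  qed
  \<comment> \<open>The solution of \<open>x\<^sub>i = b t\<^sub>i + c t\<^sub>i\<^sup>-\<^sup>1\<close> for \<open>i = 0, 1\<close>.\<close>
  define b c where "b = (q\<^sup>2 * x 0 - x 1) / (e * t 0)" and "c = (x 1 - x 0 / q\<^sup>2) * t 0 / e"
  have "b * c * e\<^sup>2 = (q\<^sup>2 * x 0 - x 1) * (x 1 - x 0 / q\<^sup>2)"
    using e t[of 0] by (simp add: b_def c_def power2_eq_square)
  also have "\<dots> = e\<^sup>2 - onsager_factor q (x 1) (x 0)"
    using q(1) by (simp add: onsager_factor_def e_def field_simps power2_eq_square)
  finally have bc: "b * c = 1" using zero[of 0] d e by simp
  then have b: "b \<noteq> 0" and c: "c = inverse b" using inverse_unique[OF bc] by auto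
  have x: "x i = b * t i + c / t i \<and> (i < d \<longrightarrow> x (Suc i) = b * t (Suc i) + c / t (Suc i))" if "i \<le> d" for i
    using that
  proof (induction i)
    case 0
    have bt: "b * t 0 * e = q\<^sup>2 * x 0 - x 1" and ct: "c / t 0 * e = x 1 - x 0 / q\<^sup>2"
      using e t[of 0] by (simp_all add: b_def c_def)
    have "x 0 * e = (b * t 0 + c / t 0) * e"
      unfolding distrib_right bt ct using q(1) by (simp add: e_def field_simps)
    moreover have "x 1 * e = (b * t 1 + c / t 1) * e"
    proof -
      have "(b * t 1 + c / t 1) * e = b * t 0 * e / q\<^sup>2 + (c / t 0 * e) * q\<^sup>2"
        using t_Suc[of 0] by (simp add: distrib_right)
      also have "\<dots> = x 1 * e"
        unfolding bt ct using q(1) by (simp add: e_def field_simps)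
      finally show ?thesis by (rule sym)
    qed
    ultimately show ?case using e by simp
  next
    case (Suc i)
    then have IH: "x i = b * t i + c / t i" "x (Suc i) = b * t (Suc i) + c / t (Suc i)" by auto
    have "x (Suc (Suc i)) = b * t (Suc (Suc i)) + c / t (Suc (Suc i))" if "Suc i < d"
    proof -
      have "(x (Suc (Suc i)) - x i) * (x (Suc (Suc i)) + x i - (q\<^sup>2 + (inverse q)\<^sup>2) * x (Suc i))
          = onsager_factor q (x (Suc (Suc i))) (x (Suc i)) - onsager_factor q (x (Suc i)) (x i)"
        by (simp add: onsager_factor_def algebra_simps power2_eq_square)
      also have "\<dots> = 0" using zero[of "Suc i"] zero[of i] that by simp
      finally have "x (Suc (Suc i)) + x i - (q\<^sup>2 + (inverse q)\<^sup>2) * x (Suc i) = 0"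
        using inj_onD[OF inj, of "Suc (Suc i)" i] that by (simp only: mult_eq_0_iff) auto
      then have "x (Suc (Suc i)) = (q\<^sup>2 + (inverse q)\<^sup>2) * x (Suc i) - x i"
        by (simp add: algebra_simps)
      also have "\<dots> = b * t (Suc (Suc i)) + c / t (Suc (Suc i))"
        unfolding IH t_Suc using t[of i] q(1) by (simp add: field_simps power2_eq_square)
      finally show ?thesis .
    qed
    then show ?case using IH by simp
  qed
  show thesis
  proof (rule that[OF b])
    show "x i = b * weight q d i + inverse (b * weight q d i)" if "i \<le> d" for i
      using x[OF that] by (simp add: c t_def divide_inverse)
  qed
qed

context linear_algebra begin

text \<open>Components of \<open>g v\<close> in eigenspaces that are not adjacent vanish, because the factor is
  nonzero there.\<close>

lemma onsager_tridiagonal: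
  assumes q: "q \<noteq> 0" "\<forall>n>0. q ^ n \<noteq> 1" and a: "a \<noteq> 0"
    and \<theta>: "\<And>i. i \<le> d \<Longrightarrow> \<theta> i = a * weight q d i + inverse (a * weight q d i)"
    and f: "lin f" and g: "lin g" and E: "eigen_system d f \<theta> E"
    and rel: "onsager_relation q f g"
    and k: "k \<le> d" "v \<in> E k"
  shows "g v \<in> (\<Sum>j | j \<le> d \<and> \<bar>int j - int k\<bar> \<le> 1. E j)"
proof -
  have inj: "inj_on \<theta> {..d}" using E by (simp add: eigen_system_def)
  have eig: "f v = \<theta> i *s v" if "i \<le> d" "v \<in> E i" for i v
    using E that by (simp add: eigen_system_def eigenspace_def)
  have sum: "(\<Sum>i\<le>d. E i) = UNIV" using E unfolding eigen_system_def by blast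
  have "g v \<in> (\<Sum>i\<le>d. E i)" by (simp only: sum UNIV_I)
  then obtain w where w: "g v = (\<Sum>i\<le>d. w i)" "\<And>i. i \<le> d \<Longrightarrow> w i \<in> E i"
    unfolding set_sum_alt[OF finite_atMost] by auto
  have "w i = 0" if i: "i \<le> d" and far: "\<not> \<bar>int i - int k\<bar> \<le> 1" for i
  proof (rule ccontr)
    assume nz: "w i \<noteq> 0"
    have ik: "i \<noteq> k" using far by auto
    then have "\<theta> i \<noteq> \<theta> k" using inj i k(1) by (auto dest: inj_onD)
    then have "onsager_factor q (\<theta> i) (\<theta> k) = 0"
      using onsager_relation_components[OF f g q(1) rel eig[OF k] inj w(1)] w(2) eig i nz by blast
    then show False using onsager_factor_adjacent[OF q a \<theta> inj i k(1) ik] far by simp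
  qed
  then have "g v = (\<Sum>j | j \<le> d \<and> \<bar>int j - int k\<bar> \<le> 1. w j)"
    unfolding w(1) by (intro sum.mono_neutral_right) auto
  then show ?thesis using w(2) by (subst set_sum_alt) auto
qed

text \<open>Otherwise \<open>g\<close> has no component from the eigenspace with index \<open>i\<close> to the one with index \<open>Suc
  i\<close>, and the sum of the eigenspaces up to \<open>i\<close> is a proper nonzero invariant subspace.\<close>

lemma onsager_consecutive:
  assumes f: "lin f" and g: "lin g" and q: "q \<noteq> 0" and rel: "onsager_relation q f g"
    and E: "eigen_system d f \<mu> E"
    and tri: "\<And>i v. i \<le> d \<Longrightarrow> v \<in> E i \<Longrightarrow> g v \<in> (\<Sum>j | j \<le> d \<and> \<bar>int j - int i\<bar> \<le> 1. E j)"
    and irreducible: "\<And>W. subspace W \<Longrightarrow> f ` W \<subseteq> W \<Longrightarrow> g ` W \<subseteq> W \<Longrightarrow> W = {0} \<or> W = UNIV"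
    and i: "i < d"
  shows "onsager_factor q (\<mu> (Suc i)) (\<mu> i) = 0"
proof (rule ccontr)
  assume nz: "onsager_factor q (\<mu> (Suc i)) (\<mu> i) \<noteq> 0"
  define F where "F n = (\<Sum>j | j \<le> d \<and> j < n. E j)" for n
  have flag: "eigenflag d f \<mu> g F"
    unfolding F_def by (rule eigenflag_of_eigen_system[OF f g E tri])
  then have F: "subspace (F n)" for n by (simp add: eigenflag_def)
  have fin: "finite {j. j \<le> d \<and> P j}" for P by (rule finite_subset[of _ "{..d}"]) auto
  have inj: "inj_on \<mu> {..d}" using E by (simp add: eigen_system_def)
  have eig: "f v = \<mu> j *s v" if "j \<le> d" "v \<in> E j" for j v
    using E that by (simp add: eigen_system_def eigenspace_def)
  have E_sub: "subspace (E j)" if "j \<le> d" for j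
    using E that subspace_eigenspace[OF f] by (simp add: eigen_system_def)
  have E_F: "E j \<subseteq> F (Suc i)" if "j \<le> i" for j
    unfolding F_def using that i E_sub by (intro subset_set_sum fin) auto
  have "f v \<in> F (Suc i)" if v: "v \<in> F (Suc i)" for v
  proof -
    have "f v - \<mu> i *s v \<in> F i" "F i \<subseteq> F (Suc i)" using flag i v by (auto simp: eigenflag_def)
    then show ?thesis using subspace_diff_scaled[OF F _ v, of "f v" "\<mu> i"] by blast
  qed
  moreover have "g v \<in> F (Suc i)" if v: "v \<in> F (Suc i)" for v
  proof -
    have "F (Suc i) \<subseteq> {v. g v \<in> F (Suc i)}"
      unfolding F_def[of "Suc i"]
    proof (rule set_sum_subset[OF fin subspace_vimage[OF g F[of "Suc i", unfolded F_def]]], fold F_def)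
      fix k assume "k \<in> {j. j \<le> d \<and> j < Suc i}"
      then have k: "k \<le> i" "k \<le> d" by auto
      show "E k \<subseteq> {v. g v \<in> F (Suc i)}"
      proof clarify
        fix v assume v: "v \<in> E k"
        obtain u where u: "g v = (\<Sum>j | j \<le> d \<and> \<bar>int j - int k\<bar> \<le> 1. u j)"
          "\<And>j. j \<le> d \<Longrightarrow> \<bar>int j - int k\<bar> \<le> 1 \<Longrightarrow> u j \<in> E j"
          using tri[OF k(2) v] unfolding set_sum_alt[OF fin] by auto
        define w where "w j = (if \<bar>int j - int k\<bar> \<le> 1 then u j else 0)" for j
        have w: "g v = (\<Sum>j\<le>d. w j)"
          unfolding u(1) w_def by (intro sum.mono_neutral_cong_left) auto
        have w_E: "w j \<in> E j" if "j \<le> d" for j using u(2) that E_sub subspace_0 by (simp add: w_def)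
        have w_i: "w j = 0" if "j \<le> d" "i < j" for j
        proof (rule ccontr)
          assume nz_j: "w j \<noteq> 0"
          then have "\<bar>int j - int k\<bar> \<le> 1" unfolding w_def by presburger
          then have jk: "j = Suc i" "k = i" using that k by auto
          then have "\<mu> j \<noteq> \<mu> k" using inj_onD[OF inj, of j k] i by auto
          then show False
            using onsager_relation_components[OF f g q rel eig[OF k(2) v] inj w eig[OF _ w_E], of j]
              nz nz_j jk that by auto
        qed
        show "g v \<in> F (Suc i)"
          unfolding w
        proof (rule subspace_sum[OF F])
          fix j assume "j \<in> {..d}"
          then show "w j \<in> F (Suc i)"
            using w_i[of j] w_E[of j] E_F[of j] subspace_0[OF F] by (cases "j \<le> i") auto
        qed
      qed
    qed
    then show ?thesis using v by blast
  qed
  ultimately have "F (Suc i) = {0} \<or> F (Suc i) = UNIV" by (intro irreducible F) auto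
  moreover have "F (Suc i) \<noteq> UNIV" "F 1 \<noteq> {0}" using flag i by (auto simp: eigenflag_def)
  moreover have "F 1 \<subseteq> F (Suc i)" using eigenflag_mono[OF flag, of 1 "Suc i"] i by simp
  ultimately show False using subspace_0[OF F[of 1]] by auto
qed

end

section \<open>Invariant subspaces of a module\<close>

lemma free_alg_induct [case_names const gen add mult]:
  fixes x :: "'f::field free_alg"
  assumes const: "\<And>c. P (free_const c)" and gen: "\<And>g. P (free_gen g)"
    and add: "\<And>x y. P x \<Longrightarrow> P y \<Longrightarrow> P (x + y)" and mult: "\<And>x y. P x \<Longrightarrow> P y \<Longrightarrow> P (x * y)"
  shows "P x"
proof -
  have word: "P (Poly_Mapping.single (Word gs) 1)" for gs
  proof (induction gs)
    case Nil
    then show ?case using const[of 1] by (simp add: zero_gen_word_def)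
  next
    case (Cons g gs)
    have "Poly_Mapping.single (Word (g # gs)) 1 = free_gen g * Poly_Mapping.single (Word gs) (1 :: 'f)"
      by (simp add: free_gen_def mult_single)
    then show ?case using gen Cons mult by metis
  qed
  show ?thesis
  proof (induction x rule: update_induct)
    case const
    then show ?case using assms(1)[of 0] by simp
  next
    case (update f w c)
    have "Poly_Mapping.update w c f = f + Poly_Mapping.single w c"
      using update(1) by (intro poly_mapping_eqI) (auto simp: lookup_update lookup_add lookup_single when_def in_keys_iff)
    moreover have "P (Poly_Mapping.single w c)"
    proof (cases w)
      case (Word gs)
      have "Poly_Mapping.single w c = free_const c * Poly_Mapping.single (Word gs) 1"
        by (simp add: mult_single Word zero_gen_word_def)
      then show ?thesis using const word mult by metis
    qed
    ultimately show ?case using update add by simp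
  qed
qed

context linear_algebra begin

lemma onsager_module_linear:
  assumes "onsager_module scale q \<rho>"
  shows "lin (\<rho> (onsager_class q x))"
  using ring_hom_closed[of \<rho> "q_onsager q" "End_ring scale" "onsager_class q x"]
    ring_hom_closed[OF onsager_class_ring_hom, of x q] assms
  by (simp add: onsager_module_def End_ring_def free_ring_def)

lemma onsager_irreducible_generators:
  assumes m: "onsager_module scale q \<rho>" and irr: "onsager_irreducible scale q \<rho>"
    and W: "subspace W" and inv: "\<And>g. \<rho> (onsager_class q (free_gen g)) ` W \<subseteq> W"
  shows "W = {0} \<or> W = UNIV"
proof -
  define h where "h x = \<rho> (onsager_class q x)" for x
  have hom: "h \<in> ring_hom free_ring (End_ring scale)"
    using ring_hom_trans[OF onsager_class_ring_hom, of \<rho> q "End_ring scale"] m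
    by (simp add: onsager_module_def h_def[abs_def] comp_def)
  have h_mult: "h (x * y) = h x \<circ> h y" and h_add: "h (x + y) = (\<lambda>v. h x v + h y v)" for x y
    using ring_hom_mult[OF hom, of x y] ring_hom_add[OF hom, of x y]
    by (simp_all add: free_ring_def End_ring_def)
  have h_const: "h (free_const c) = scale c" for c
    using m by (simp add: h_def onsager_module_def)
  have h: "h x ` W \<subseteq> W" for x
  proof (induction x rule: free_alg_induct)
    case (const c)
    then show ?case using subspace_scale[OF W] by (auto simp: h_const)
  next
    case (gen g)
    then show ?case using inv by (simp add: h_def)
  next
    case (add x y)
    then show ?case using subspace_add[OF W] by (auto simp: h_add)
  next
    case (mult x y)
    then show ?case by (auto simp: h_mult)
  qed
  have "\<rho> x ` W \<subseteq> W" if x: "x \<in> carrier (q_onsager q)" for x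
  proof -
    obtain y where "x = onsager_class q y"
      using x by (auto simp: q_onsager_def FactRing_def A_RCOSETS_def' onsager_class_def)
    then show ?thesis using h[of y] by (simp add: h_def)
  qed
  then show ?thesis using irr W unfolding onsager_irreducible_def by blast
qed

section \<open>The eight triples\<close>

lemma corresponding_map_props:
  assumes "decomposition scale d W"
  shows "lin (corresponding_map scale q d W)"
    and "i \<le> d \<Longrightarrow> v \<in> W i \<Longrightarrow> corresponding_map scale q d W v = weight q d i *s v"
  using theI'[OF corresponding_map_ex1[OF vector_space_axioms assms, of q]]
  unfolding corresponding_map_def[symmetric] weight_def by blast+

lemma identity_on_decomposition:
  assumes "decomposition scale d W" "lin f" "\<And>i v. i \<le> d \<Longrightarrow> v \<in> W i \<Longrightarrow> f v = v"
  shows "f v = v"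
proof -
  have sub: "(\<Sum>i\<le>d. W i) \<subseteq> {v. f v - v \<in> {0}}"
    using assms(3) by (intro set_sum_subset subspace_vimage[OF lin_diff[OF assms(2) lin_ident]] subspace_single_0) auto
  have "(\<Sum>i\<le>d. W i) = UNIV" using assms(1) by (simp add: decomposition_def)
  then have "v \<in> {v. f v - v \<in> {0}}" using sub by blast
  then show ?thesis by simp
qed

text \<open>This makes the triples that contain inverses instances of those that do not, with \<open>q\<close>
  inverted.\<close>

lemma corresponding_map_inverse:
  assumes dec: "decomposition scale d W" and q: "q \<noteq> 0"
  shows "inv\<^bsub>End_ring scale\<^esub> (corresponding_map scale q d W) = corresponding_map scale (inverse q) d W"
proof -
  note f = corresponding_map_props[OF dec]
  have *: "corresponding_map scale q d W (corresponding_map scale (inverse q) d W v) = v" if "q \<noteq> 0" for q v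
  proof (rule identity_on_decomposition[OF dec lin_comp[OF f(1) f(1)]])
    fix i v assume "i \<le> d" "v \<in> W i"
    then show "corresponding_map scale q d W (corresponding_map scale (inverse q) d W v) = v"
      using weight_nonzero[OF that, of d i] by (simp add: f weight_inverse lin_simps[OF f(1)])
  qed
  show ?thesis
    using *[of q] *[of "inverse q"] q by (intro End_ring_inverse(2) f(1)) auto
qed

text \<open>The second triple exchanges \<open>G\<close> and \<open>H\<close> and inverts \<open>a\<close>; the third inverts \<open>q\<close>, \<open>a\<close> and \<open>b\<close>;
  the fourth combines the two.\<close>

lemma equitable_triples_of_splits:
  assumes KS: "split_decomposition scale d X Y \<mu> \<eta> F G" and BS: "split_decomposition scale d X Y \<mu> \<eta>' F H"
    and q: "q \<noteq> 0" "q\<^sup>2 \<noteq> 1" and a: "a \<noteq> 0" "a\<^sup>2 \<noteq> 1" and b: "b \<noteq> 0"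
    and \<mu>: "\<And>i. i \<le> d \<Longrightarrow> \<mu> i = b * weight q d i + inverse (b * weight q d i)"
    and \<eta>: "\<And>i. i \<le> d \<Longrightarrow> \<eta> (d - i) = a * weight q d i + inverse (a * weight q d i)"
    and \<eta>': "\<And>i. i \<le> d \<Longrightarrow> \<eta>' (d - i) = inverse a * weight q d i + inverse (inverse a * weight q d i)"
    and W: "\<And>i. i \<le> d \<Longrightarrow> W i = F (Suc i) \<inter> G (Suc d - i)" "\<And>i. i \<le> d \<Longrightarrow> W' i = F (Suc i) \<inter> H (Suc d - i)"
    and K: "K = corresponding_map scale q d W" and B: "B = corresponding_map scale q d W'"
    and Ki: "Ki = inv\<^bsub>End_ring scale\<^esub> K" and Bi: "Bi = inv\<^bsub>End_ring scale\<^esub> B"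
    and M: "M = (\<lambda>v. (1 / (a - inverse a)) *s (a *s K v - inverse a *s B v))"
    and N: "N = (\<lambda>v. (1 / (inverse a - a)) *s (inverse a *s Ki v - a *s Bi v))"
  shows "equitable_triple scale q (\<lambda>v. a *s Y v - a\<^sup>2 *s K v) (inv\<^bsub>End_ring scale\<^esub> M) K"
    and "equitable_triple scale q (\<lambda>v. inverse a *s Y v - (inverse a)\<^sup>2 *s B v) (inv\<^bsub>End_ring scale\<^esub> M) B"
    and "equitable_triple scale q Ki (inv\<^bsub>End_ring scale\<^esub> N) (\<lambda>v. inverse a *s Y v - (inverse a)\<^sup>2 *s Ki v)"
    and "equitable_triple scale q Bi (inv\<^bsub>End_ring scale\<^esub> N) (\<lambda>v. a *s Y v - a\<^sup>2 *s Bi v)"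
proof -
  interpret KS: split_decomposition scale d X Y \<mu> \<eta> F G by (rule KS)
  interpret BS: split_decomposition scale d X Y \<mu> \<eta>' F H by (rule BS)
  have dec: "decomposition scale d W" "decomposition scale d W'"
    using KS.decomposition_U BS.decomposition_U W
    by (simp_all add: decomposition_def KS.U_def BS.U_def)
  have Ki': "Ki = corresponding_map scale (inverse q) d W"
    and Bi': "Bi = corresponding_map scale (inverse q) d W'"
    unfolding Ki Bi K B by (rule corresponding_map_inverse[OF _ q(1)]; rule dec)+
  note cm = corresponding_map_props[OF dec(1), where q = q, folded K]
    corresponding_map_props[OF dec(2), where q = q, folded B]
    corresponding_map_props[OF dec(1), where q = "inverse q", folded Ki']
    corresponding_map_props[OF dec(2), where q = "inverse q", folded Bi']
  have inv: "inverse q \<noteq> 0" "(inverse q)\<^sup>2 \<noteq> 1" "inverse a \<noteq> 0" "(inverse a)\<^sup>2 \<noteq> 1" "inverse b \<noteq> 0"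
    using q a b by (auto simp: power_inverse)
  have M': "(\<lambda>v. (1 / (inverse a - inverse (inverse a))) *s (inverse a *s B v - inverse (inverse a) *s K v)) = M"
    unfolding M inverse_inverse_eq by (rule ext) (rule scale_difference_quotient)
  have N': "(\<lambda>v. (1 / (a - inverse a)) *s (a *s Bi v - inverse a *s Ki v)) = N"
    unfolding N by (rule ext) (rule scale_difference_quotient)
  show "equitable_triple scale q (\<lambda>v. a *s Y v - a\<^sup>2 *s K v) (inv\<^bsub>End_ring scale\<^esub> M) K"
    unfolding M by (rule equitable_triple_of_splits[OF KS BS q a b \<mu> \<eta> \<eta>' cm(1) _ cm(3)]) (simp_all add: cm W)
  show "equitable_triple scale q (\<lambda>v. inverse a *s Y v - (inverse a)\<^sup>2 *s B v) (inv\<^bsub>End_ring scale\<^esub> M) B"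
    unfolding M'[symmetric]
    by (rule equitable_triple_of_splits[OF BS KS q inv(3,4) b \<mu> \<eta>' _ cm(3) _ cm(1)]) (simp_all add: cm W \<eta>)
  show "equitable_triple scale q Ki (inv\<^bsub>End_ring scale\<^esub> N) (\<lambda>v. inverse a *s Y v - (inverse a)\<^sup>2 *s Ki v)"
    unfolding N
    by (rule equitable_triple_inverse,
        rule equitable_triple_of_splits[OF KS BS inv _ _ _ cm(5) _ cm(7), unfolded inverse_inverse_eq])
      (simp_all add: cm W \<eta> \<eta>' \<mu> weight_inverse)
  show "equitable_triple scale q Bi (inv\<^bsub>End_ring scale\<^esub> N) (\<lambda>v. a *s Y v - a\<^sup>2 *s Bi v)"
    unfolding N'[symmetric]
    by (rule equitable_triple_inverse,
        rule equitable_triple_of_splits[OF BS KS inv(1,2) a inv(5) _ _ _ cm(7) _ cm(5)])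
      (simp_all add: cm W \<eta> \<eta>' \<mu> weight_inverse)
qed

end

theorem proposition7p4:
  fixes scale :: "'f::field \<Rightarrow> 'v::ab_group_add \<Rightarrow> 'v" (infixr "*s" 75)
    and \<rho> :: "'f free_alg set \<Rightarrow> 'v \<Rightarrow> 'v"
    and q a :: 'f
    and d :: nat
    and \<theta> :: "nat \<Rightarrow> 'f"
    and V Vs :: "nat \<Rightarrow> 'v set"
    and A As K B Kd Bd M N Md Nd Ki Bi Kdi Bdi :: "'v \<Rightarrow> 'v"
  assumes q_nonzero: "q \<noteq> 0"
    and q_not_root_of_unity: "\<forall>n>0. q ^ n \<noteq> 1"
    and vector_space: "vector_space scale"
    and finite_dim: "\<exists>S. finite S \<and> module.span scale S = UNIV"
    and dim_ge_2: "vector_space.dim scale (UNIV :: 'v set) \<ge> 2"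
    and module: "onsager_module scale q \<rho>"
    and irreducible: "onsager_irreducible scale q \<rho>"
    and A_def: "A = \<rho> (onsager_class q (free_gen Gen_A))"
    and As_def: "As = \<rho> (onsager_class q (free_gen Gen_Astar))"
    and A_diag: "diagonalizable scale A"
    and As_diag: "diagonalizable scale As"
    and d_ge_1: "1 \<le> d"
    and a_nonzero: "a \<noteq> 0"
    and \<theta>_formula: "\<forall>i\<le>d. \<theta> i = a * q powi (int d - 2 * int i) + inverse a * q powi (2 * int i - int d)"
    and \<theta>_distinct: "inj_on \<theta> {..d}"
    and \<theta>_eigenvalues: "\<theta> ` {..d} = eigenvalues scale A"
    and V_def: "\<forall>i\<le>d. V i = eigenspace scale A (\<theta> i)"
    and Vs_eigenspaces: "bij_betw Vs {..d} (eigenspace scale As ` eigenvalues scale As)"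
    and Vs_tridiagonal: "\<forall>i\<le>d. A ` Vs i \<subseteq> (\<Sum>j | j \<le> d \<and> \<bar>int j - int i\<bar> \<le> 1. Vs j)"
    and K_def: "K = corresponding_map scale q d (\<lambda>i. (\<Sum>j\<in>{0..i}. Vs j) \<inter> (\<Sum>j\<in>{i..d}. V j))"
    and B_def: "B = corresponding_map scale q d (\<lambda>i. (\<Sum>j\<in>{0..i}. Vs j) \<inter> (\<Sum>j\<in>{0..d-i}. V j))"
    and Kd_def: "Kd = corresponding_map scale q d (\<lambda>i. (\<Sum>j\<in>{d-i..d}. Vs j) \<inter> (\<Sum>j\<in>{i..d}. V j))"
    and Bd_def: "Bd = corresponding_map scale q d (\<lambda>i. (\<Sum>j\<in>{d-i..d}. Vs j) \<inter> (\<Sum>j\<in>{0..d-i}. V j))"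
    and Ki_def: "Ki = inv\<^bsub>End_ring scale\<^esub> K"
    and Bi_def: "Bi = inv\<^bsub>End_ring scale\<^esub> B"
    and Kdi_def: "Kdi = inv\<^bsub>End_ring scale\<^esub> Kd"
    and Bdi_def: "Bdi = inv\<^bsub>End_ring scale\<^esub> Bd"
    and M_def: "M = (\<lambda>v. (1 / (a - inverse a)) *s (a *s K v - inverse a *s B v))"
    and N_def: "N = (\<lambda>v. (1 / (inverse a - a)) *s (inverse a *s Ki v - a *s Bi v))"
    and Md_def: "Md = (\<lambda>v. (1 / (a - inverse a)) *s (a *s Kd v - inverse a *s Bd v))"
    and Nd_def: "Nd = (\<lambda>v. (1 / (inverse a - a)) *s (inverse a *s Kdi v - a *s Bdi v))"
  shows
    "equitable_triple scale q (\<lambda>v. a *s A v - a\<^sup>2 *s K v) (inv\<^bsub>End_ring scale\<^esub> M) K \<and>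
     equitable_triple scale q (\<lambda>v. inverse a *s A v - (inverse a)\<^sup>2 *s B v) (inv\<^bsub>End_ring scale\<^esub> M) B \<and>
     equitable_triple scale q (\<lambda>v. a *s A v - a\<^sup>2 *s Kd v) (inv\<^bsub>End_ring scale\<^esub> Md) Kd \<and>
     equitable_triple scale q (\<lambda>v. inverse a *s A v - (inverse a)\<^sup>2 *s Bd v) (inv\<^bsub>End_ring scale\<^esub> Md) Bd \<and>
     equitable_triple scale q Ki (inv\<^bsub>End_ring scale\<^esub> N) (\<lambda>v. inverse a *s A v - (inverse a)\<^sup>2 *s Ki v) \<and>
     equitable_triple scale q Bi (inv\<^bsub>End_ring scale\<^esub> N) (\<lambda>v. a *s A v - a\<^sup>2 *s Bi v) \<and>
     equitable_triple scale q Kdi (inv\<^bsub>End_ring scale\<^esub> Nd) (\<lambda>v. inverse a *s A v - (inverse a)\<^sup>2 *s Kdi v) \<and>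
     equitable_triple scale q Bdi (inv\<^bsub>End_ring scale\<^esub> Nd) (\<lambda>v. a *s A v - a\<^sup>2 *s Bdi v)"
proof -
  interpret linear_algebra scale using vector_space by (simp add: linear_algebra_def)
  have lin: "lin A" "lin As"
    unfolding A_def As_def by (rule onsager_module_linear[OF module])+
  have irr: "W = {0} \<or> W = UNIV" if "subspace W" "A ` W \<subseteq> W" "As ` W \<subseteq> W" for W
  proof (rule onsager_irreducible_generators[OF module irreducible that(1)])
    show "\<rho> (onsager_class q (free_gen g)) ` W \<subseteq> W" for g
      using that by (cases g) (simp_all add: A_def As_def)
  qed
  have rel: "onsager_relation q A As" "onsager_relation q As A"
    using onsager_module_relations[OF vector_space module, of "free_gen Gen_A" "free_gen Gen_Astar"]
      onsager_module_relations[OF vector_space module, of "free_gen Gen_Astar" "free_gen Gen_A"]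
    unfolding onsager_relation_def commutator_def[abs_def] q_commutator_def[abs_def] A_def As_def
    by (simp_all add: insert_commute)
  have q2: "q\<^sup>2 \<noteq> 1" and q4: "q ^ 4 \<noteq> 1" using q_not_root_of_unity by simp_all
  have \<theta>: "\<theta> i = a * weight q d i + inverse (a * weight q d i)" if "i \<le> d" for i
    using \<theta>_formula that by (simp add: weight_def power_int_minus[symmetric])
  have V: "eigen_system d A \<theta> V"
    using V_def by (intro eigen_system_diagonalizable lin A_diag \<theta>_distinct \<theta>_eigenvalues) auto
  obtain \<mu> where \<mu>: "\<And>i. i \<le> d \<Longrightarrow> \<mu> i \<in> eigenvalues scale As" "\<And>i. i \<le> d \<Longrightarrow> Vs i = eigenspace scale As (\<mu> i)"
  proof -
    have "\<forall>i\<in>{..d}. \<exists>c. c \<in> eigenvalues scale As \<and> Vs i = eigenspace scale As c"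
      using bij_betw_imp_surj_on[OF Vs_eigenspaces] by blast
    from bchoice[OF this] show ?thesis using that by auto
  qed
  have Vs: "eigen_system d As \<mu> Vs"
  proof (rule eigen_system_diagonalizable[OF lin(2) As_diag _ _ \<mu>(2)])
    show "inj_on \<mu> {..d}"
      using Vs_eigenspaces \<mu>(2) unfolding bij_betw_def inj_on_def by (metis atMost_iff)
    show "\<mu> ` {..d} = eigenvalues scale As"
    proof
      show "\<mu> ` {..d} \<subseteq> eigenvalues scale As" using \<mu>(1) by auto
      show "eigenvalues scale As \<subseteq> \<mu> ` {..d}"
      proof
        fix c assume c: "c \<in> eigenvalues scale As"
        then obtain v where v: "v \<noteq> 0" "As v = c *s v" by (auto simp: eigenvalues_def)
        have "eigenspace scale As c \<in> Vs ` {..d}"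
          using c unfolding bij_betw_imp_surj_on[OF Vs_eigenspaces] by (rule imageI)
        then obtain i where i: "i \<le> d" "eigenspace scale As c = Vs i" by auto
        have "v \<in> eigenspace scale As (\<mu> i)"
          using v(2) unfolding \<mu>(2)[OF i(1), symmetric] i(2)[symmetric] by (simp add: eigenspace_def)
        then have "c *s v = \<mu> i *s v" using v(2) by (simp add: eigenspace_def)
        then have "c = \<mu> i" using v by simp
        then show "c \<in> \<mu> ` {..d}" using i by auto
      qed
    qed
  qed
  have tri_V: "As v \<in> (\<Sum>j | j \<le> d \<and> \<bar>int j - int i\<bar> \<le> 1. V j)" if "i \<le> d" "v \<in> V i" for i v
    by (rule onsager_tridiagonal[OF q_nonzero q_not_root_of_unity a_nonzero \<theta> lin V rel(1) that])
  have tri_Vs: "A v \<in> (\<Sum>j | j \<le> d \<and> \<bar>int j - int i\<bar> \<le> 1. Vs j)" if "i \<le> d" "v \<in> Vs i" for i v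
    using Vs_tridiagonal that by blast
  have inj_\<mu>: "inj_on \<mu> {..d}" using Vs by (simp add: eigen_system_def)
  have consecutive: "onsager_factor q (\<mu> (Suc i)) (\<mu> i) = 0" if "i < d" for i
    by (rule onsager_consecutive[OF lin(2,1) q_nonzero rel(2) Vs tri_Vs irr that])
  obtain b where b: "b \<noteq> 0" "\<And>i. i \<le> d \<Longrightarrow> \<mu> i = b * weight q d i + inverse (b * weight q d i)"
    using onsager_sequence[OF q_nonzero q4 d_ge_1 inj_\<mu> consecutive] by blast
  \<comment> \<open>If \<open>a\<close> is its own inverse, then \<open>\<theta>\<close> takes the same value at \<open>0\<close> and \<open>d\<close>.\<close>
  have a2: "a\<^sup>2 \<noteq> 1"
  proof
    assume "a\<^sup>2 = 1"
    then have "inverse a = a" using a_nonzero by (simp add: power2_eq_square inverse_unique)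
    then have "\<theta> 0 = \<theta> d" using \<theta>_formula d_ge_1 by (simp add: add.commute)
    then show False using inj_onD[OF \<theta>_distinct, of 0 d] d_ge_1 by simp
  qed
  note split = split_decomposition.intro[OF linear_algebra_axioms split_decomposition_axioms.intro, OF lin(2,1) _ _ irr]
  \<comment> \<open>\<open>K\<close> and its variant with a down arrow need the eigenspaces of \<open>A\<close> from the end \<open>d\<close>, since the
    flags of the split decomposition increase.\<close>
  note flag_Vs = eigenflag_of_eigen_system[OF lin(2,1) Vs tri_Vs]
    and flag_Vs_rev = eigenflag_of_eigen_system_reverse[OF lin(2,1) Vs tri_Vs]
    and flag_V = eigenflag_of_eigen_system[OF lin V tri_V]
    and flag_V_rev = eigenflag_of_eigen_system_reverse[OF lin V tri_V]
  have sets: "{0..i} = {j. j \<le> d \<and> j < Suc i}" "{i..d} = {j. j \<le> d \<and> d < j + (Suc d - i)}"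
    "{0..d - i} = {j. j \<le> d \<and> j < Suc d - i}" "{d - i..d} = {j. j \<le> d \<and> d < j + Suc i}" if "i \<le> d" for i
    using that by auto
  have up: "split_decomposition scale d As A \<mu> (\<lambda>n. \<theta> (d - n))
      (\<lambda>n. \<Sum>j | j \<le> d \<and> j < n. Vs j) (\<lambda>n. \<Sum>j | j \<le> d \<and> d < j + n. V j)"
     "split_decomposition scale d As A \<mu> \<theta>
      (\<lambda>n. \<Sum>j | j \<le> d \<and> j < n. Vs j) (\<lambda>n. \<Sum>j | j \<le> d \<and> j < n. V j)"
    by (rule split[OF flag_Vs flag_V_rev] split[OF flag_Vs flag_V]; assumption)+
  have down: "split_decomposition scale d As A (\<lambda>n. \<mu> (d - n)) (\<lambda>n. \<theta> (d - n))
      (\<lambda>n. \<Sum>j | j \<le> d \<and> d < j + n. Vs j) (\<lambda>n. \<Sum>j | j \<le> d \<and> d < j + n. V j)"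
     "split_decomposition scale d As A (\<lambda>n. \<mu> (d - n)) \<theta>
      (\<lambda>n. \<Sum>j | j \<le> d \<and> d < j + n. Vs j) (\<lambda>n. \<Sum>j | j \<le> d \<and> j < n. V j)"
    by (rule split[OF flag_Vs_rev flag_V_rev] split[OF flag_Vs_rev flag_V]; assumption)+
  have b': "inverse b \<noteq> 0" using b by simp
  note triples = equitable_triples_of_splits[OF up q_nonzero q2 a_nonzero a2 b(1) b(2) _ _ _ _
      K_def B_def Ki_def Bi_def M_def N_def]
    and triples_down = equitable_triples_of_splits[OF down q_nonzero q2 a_nonzero a2 b' _ _ _ _ _
      Kd_def Bd_def Kdi_def Bdi_def Md_def Nd_def]
  show ?thesis
    by (intro conjI triples triples_down) (simp_all add: \<theta> b(2) weight_reverse sets Suc_diff_le add.commute)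
qed

end
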